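(* Let $N \geq 1$ be an integer and let $X \subset \mathbb{C}^N$ be a compact set whose polynomial hull is nontrivial, i.e. $\widehat{X} \setminus X \neq \emptyset$. Then there exists a compact set $Y \subset \mathbb{C}^{N+1}$ such that, letting $\pi : \widehat{Y} \to \mathbb{C}^N$ denote the restriction to $\widehat{Y}$ of the projection $\mathbb{C}^{N+1} \to \mathbb{C}^N$ onto the first $N$ coordinates, the following conditions hold: (i) $\pi(Y) = X$; (ii) $\pi(\widehat{Y} \setminus Y) = \widehat{X} \setminus X$; (iii) $\widehat{Y}$ contains no analytic discs; (iv) for each $z \in \widehat{X}$, the fiber $\pi^{-1}(z)$ is totally disconnected.
   Context: For a compact set $X \subset \mathbb{C}^N$, the polynomial hull of $X$ is $\widehat{X} = \{ z \in \mathbb{C}^N : |p(z)| \leq \max_{x \in X} |p(x)| \text{ for all polynomials } p \}$, where the polynomials are holomorphic polynomials in $N$ complex variables with complex coefficients. The polynomial hull of $X$ is said to be nontrivial if $\widehat{X} \setminus X$ is nonempty. An analytic disc in $\mathbb{C}^N$ is an injective holomorphic map $\sigma : \{ z \in \mathbb{C} : |z| < 1 \} \to \mathbb{C}^N$. A subset $S$ of $\mathbb{C}^N$ is said to contain no analytic discs if there is no analytic disc in $\mathbb{C}^N$ whose image is contained in $S$. The same definitions are used with $N+1$ in place of $N$. *)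

theory Defs
  imports "HOL-Analysis.Analysis"
begin

(* C^N is rendered as complex ^ 'n with N = CARD('n), and C^(N+1) as complex ^ 'n option:
   the indices Some i are the first N coordinates, None is the last one. *)

(* The coefficient of the monomial with exponent vector a is c a. *)
definition complex_polynomial :: "(complex ^ 'n \<Rightarrow> complex) \<Rightarrow> bool" where
  "complex_polynomial p \<longleftrightarrow>
     (\<exists>(A :: ('n \<Rightarrow> nat) set) c. finite A \<and>
        p = (\<lambda>z. \<Sum>a\<in>A. c a * (\<Prod>i\<in>UNIV. (z $ i) ^ a i)))"

(* Meant for compact X: then the supremum is a maximum if X is nonempty. For X = {} the
   supremum is an unspecified real number, which some constant polynomial exceeds in modulus,
   so the hull of {} is {}. *)
definition polynomial_hull :: "(complex ^ 'n) set \<Rightarrow> (complex ^ 'n) set" where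
  "polynomial_hull X =
     {z. \<forall>p. complex_polynomial p \<longrightarrow> cmod (p z) \<le> (SUP x\<in>X. cmod (p x))}"

(* Only the values of \<sigma> on the open unit disc matter. A map into C^N is holomorphic
   iff its components are. *)
definition analytic_disc :: "(complex \<Rightarrow> complex ^ 'n) \<Rightarrow> bool" where
  "analytic_disc \<sigma> \<longleftrightarrow>
     (\<forall>i. (\<lambda>z. \<sigma> z $ i) holomorphic_on ball 0 1) \<and> inj_on \<sigma> (ball 0 1)"

definition contains_no_analytic_discs :: "(complex ^ 'n) set \<Rightarrow> bool" where
  "contains_no_analytic_discs S \<longleftrightarrow> \<not> (\<exists>\<sigma>. analytic_disc \<sigma> \<and> \<sigma> ` ball 0 1 \<subseteq> S)"

(* Every connected subset has at most one point; in particular {} is totally disconnected. *)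
definition totally_disconnected :: "'a::topological_space set \<Rightarrow> bool" where
  "totally_disconnected S \<longleftrightarrow> (\<forall>T \<subseteq> S. connected T \<longrightarrow> (\<forall>x\<in>T. \<forall>y\<in>T. x = y))"

definition first_coords :: "complex ^ 'n option \<Rightarrow> complex ^ 'n" where
  "first_coords w = (\<chi> i. w $ Some i)"

end

theory Submission
  imports Defs "HOL-Complex_Analysis.Great_Picard"
begin

text \<open>
  Write \<open>H\<close> for the hull of \<open>X\<close>. The set \<open>Y\<close> is the graph over \<open>X\<close> of a multivalued function, the sum of
  the series \<open>\<pm>\<surd>d\<^sub>0 \<pm> \<surd>d\<^sub>1 \<pm> \<surd>d\<^sub>2 \<pm> \<dots>\<close> with all choices of signs admitted, where the \<open>d\<^sub>j\<close> are
  polynomials on \<open>\<complex>\<^sup>N\<close> that are extremely small on \<open>H\<close>. The hull of \<open>Y\<close> is the graph of the same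
  multivalued function over \<open>H\<close>, which gives the statements about projections at once.

  The hull contains the graph over \<open>H\<close>, because the polynomials in \<open>z\<close> and a partial sum \<open>w\<close> obey the
  maximum principle from \<open>X\<close> to \<open>H\<close> (\<open>root_sums_hull_bound\<close>): adjoining one root at a time, the trace
  and norm of a polynomial are polynomials in the variables of the stage before, and they control the
  polynomial itself. It is contained in the graph, because the \<open>2\<^sup>n\<close> partial sums of length \<open>n\<close> are the
  zeros in \<open>w\<close> of a polynomial in \<open>(z, w)\<close> (\<open>root_sums_eliminant\<close>) that is tiny on \<open>Y\<close>, hence tiny on
  the hull. To conclude that \<open>w\<close> is near a zero one takes a \<open>2\<^sup>n\<close>-th root, and this is why the tails of
  the series have to decrease as fast as \<open>(n + 2) ^ (- 2 ^ n)\<close>. The fibres are covered by \<open>2\<^sup>n\<close> discs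
  of such a radius, so they have length zero and are totally disconnected.

  To exclude analytic discs, each \<open>d\<^sub>j\<close> is a multiple of \<open>(z\<^sub>i - a\<^sub>j) ^ (2 j + 1)\<close>, where the values \<open>a\<^sub>j\<close>
  that occur with a given coordinate \<open>z\<^sub>i\<close> are dense in the plane. A disc on which all \<open>z\<^sub>i\<close> are constant
  lies in a fibre. On any other disc some \<open>z\<^sub>i\<close> takes one of its values \<open>a\<^sub>k\<close> with nonzero derivative, and
  at such a point \<open>w\<close> must branch like a square root. For partial sums this is
  \<open>no_holomorphic_root_sum_near_simple_zero\<close>; the exponents \<open>2 j + 1\<close> are distinct so that the branching
  of several terms cannot cancel. The rest of the series is dealt with by choosing the
  coefficients one after another: by Montel's theorem, a whole neighbourhood of the graph of the
  \<open>n\<close>-th partial sums is free of discs that pass through a value \<open>a\<^sub>k\<close>, \<open>k < n\<close>, with steepness at least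
  \<open>1 / (n + 1)\<close> at the centre (\<open>no_transversal_disc_near_root_sums\<close>), and the later coefficients are so
  small that the limit stays in this neighbourhood. Every disc with nonconstant projection contains
  a smaller disc of this kind for some \<open>n\<close> (\<open>transversal_subdisc\<close>).
\<close>

section \<open>Complex polynomials in several variables\<close>

text \<open>
  The monomials may repeat here, unlike in the definition of a polynomial, where the exponent vectors
  index the sum. Sums and products of polynomials produce repetitions.
\<close>

lemma complex_polynomial_indexed_sum:
  assumes "finite I"
  shows "complex_polynomial (\<lambda>z :: complex ^ 'n. \<Sum>x\<in>I. c x * (\<Prod>i\<in>UNIV. (z $ i) ^ e x i))"
proof -
  let ?C = "\<lambda>a. \<Sum>x\<in>{x\<in>I. e x = a}. c x"
  have "(\<Sum>x\<in>I. c x * (\<Prod>i\<in>UNIV. (z $ i) ^ e x i)) = (\<Sum>a\<in>e ` I. ?C a * (\<Prod>i\<in>UNIV. (z $ i) ^ a i))"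
    for z :: "complex ^ 'n"
    by (subst sum.image_gen[OF assms, where g = e])
      (auto simp: sum_distrib_right intro!: sum.cong)
  then show ?thesis
    unfolding complex_polynomial_def using assms
    by (intro exI[of _ "e ` I"] exI[of _ ?C] conjI) auto
qed

lemma complex_polynomial_const: "complex_polynomial (\<lambda>z :: complex ^ 'n. k)"
  using complex_polynomial_indexed_sum[of "{()}" "\<lambda>_. k" "\<lambda>_ _. 0"] by simp

lemma complex_polynomial_coord: "complex_polynomial (\<lambda>z :: complex ^ 'n. z $ i)"
proof -
  have "(\<Prod>l\<in>UNIV. (z $ l) ^ (if l = i then 1 else 0)) = z $ i" for z :: "complex ^ 'n"
    by (simp add: if_distrib[of "\<lambda>k. _ ^ k"] cong: if_cong)
  then show ?thesis
    using complex_polynomial_indexed_sum[of "{()}" "\<lambda>_. 1" "\<lambda>_ l. if l = i then 1 else 0"] by simp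
qed

lemma complex_polynomial_add:
  assumes "complex_polynomial p" "complex_polynomial q"
  shows "complex_polynomial (\<lambda>z. p z + q z)"
proof -
  obtain A c where p: "finite A" "p = (\<lambda>z. \<Sum>a\<in>A. c a * (\<Prod>i\<in>UNIV. (z $ i) ^ a i))"
    using assms unfolding complex_polynomial_def by blast
  obtain B d where q: "finite B" "q = (\<lambda>z. \<Sum>a\<in>B. d a * (\<Prod>i\<in>UNIV. (z $ i) ^ a i))"
    using assms unfolding complex_polynomial_def by blast
  show ?thesis
    using complex_polynomial_indexed_sum[of "A <+> B" "case_sum c d" "case_sum id id"] p q
    by (simp add: sum.Plus)
qed

lemma complex_polynomial_mult:
  assumes "complex_polynomial p" "complex_polynomial q"
  shows "complex_polynomial (\<lambda>z. p z * q z)"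
proof -
  obtain A c where p: "finite A" "p = (\<lambda>z. \<Sum>a\<in>A. c a * (\<Prod>i\<in>UNIV. (z $ i) ^ a i))"
    using assms unfolding complex_polynomial_def by blast
  obtain B d where q: "finite B" "q = (\<lambda>z. \<Sum>a\<in>B. d a * (\<Prod>i\<in>UNIV. (z $ i) ^ a i))"
    using assms unfolding complex_polynomial_def by blast
  have "p z * q z = (\<Sum>x\<in>A \<times> B. (c (fst x) * d (snd x)) * (\<Prod>i\<in>UNIV. (z $ i) ^ (fst x i + snd x i)))" for z
    unfolding p q sum_product sum.cartesian_product
    by (auto simp: power_add prod.distrib intro!: sum.cong)
  then show ?thesis
    using complex_polynomial_indexed_sum[of "A \<times> B" "\<lambda>x. c (fst x) * d (snd x)" "\<lambda>x i. fst x i + snd x i"] p(1) q(1)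
    by simp
qed

lemma complex_polynomial_power:
  "complex_polynomial p \<Longrightarrow> complex_polynomial (\<lambda>z. p z ^ k)"
  by (induction k) (auto intro: complex_polynomial_const complex_polynomial_mult)

lemmas complex_polynomial_intros =
  complex_polynomial_const complex_polynomial_coord complex_polynomial_add complex_polynomial_mult
  complex_polynomial_power

lemma complex_polynomial_diff:
  assumes "complex_polynomial p" "complex_polynomial q"
  shows "complex_polynomial (\<lambda>z. p z - q z)"
  using complex_polynomial_add[OF assms(1) complex_polynomial_mult[OF complex_polynomial_const[of "-1"] assms(2)]]
  by simp

text \<open>
  Polynomials are the algebra generated by constants and coordinates; properties of polynomials are
  proved below from this description instead of the explicit sums.
\<close>

lemma complex_polynomial_induct [consumes 1, case_names const coord add mult]:
  fixes p :: "complex ^ 'n \<Rightarrow> complex"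
  assumes "complex_polynomial p"
    and const: "\<And>k. P (\<lambda>z. k)"
    and coord: "\<And>i. P (\<lambda>z. z $ i)"
    and add: "\<And>p q. P p \<Longrightarrow> P q \<Longrightarrow> P (\<lambda>z. p z + q z)"
    and mult: "\<And>p q. P p \<Longrightarrow> P q \<Longrightarrow> P (\<lambda>z. p z * q z)"
  shows "P p"
proof -
  obtain A c where p: "finite A" "p = (\<lambda>z. \<Sum>a\<in>A. c a * (\<Prod>i\<in>UNIV. (z $ i) ^ a i))"
    using assms(1) unfolding complex_polynomial_def by blast
  have pow: "P (\<lambda>z. (z $ i) ^ k)" for i k
    by (induction k) (auto intro: const coord mult)
  have "finite I \<Longrightarrow> P (\<lambda>z. \<Prod>i\<in>I. (z $ i) ^ a i)" for a I
    by (induction I rule: finite_induct) (auto intro: const mult pow)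
  then have mono: "P (\<lambda>z. \<Prod>i\<in>UNIV. (z $ i) ^ a i)" for a
    by simp
  show ?thesis
    unfolding p(2) using p(1)
  proof (induction A rule: finite_induct)
    case empty
    then show ?case using const[of 0] by simp
  next
    case (insert a A)
    then show ?case using add[OF mult[OF const[of "c a"] mono[of a]] insert.IH] by simp
  qed
qed

lemma complex_polynomial_compose:
  assumes "complex_polynomial q" "\<And>i. complex_polynomial (\<lambda>x. g x $ i)"
  shows "complex_polynomial (\<lambda>x. q (g x))"
  using assms(1) by (induction rule: complex_polynomial_induct) (auto intro: assms(2) complex_polynomial_intros)

lemma complex_polynomial_continuous_on:
  "complex_polynomial p \<Longrightarrow> continuous_on S p"
  by (induction rule: complex_polynomial_induct) (auto intro!: continuous_intros)

section \<open>Polynomial hulls\<close>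

text \<open>
  This form avoids the supremum: it is used both to show that points lie in a hull and to
  transfer explicit bounds from \<open>X\<close> to its hull.
\<close>

lemma mem_polynomial_hull_iff:
  fixes X :: "(complex ^ 'n) set"
  assumes "compact X" "X \<noteq> {}"
  shows "z \<in> polynomial_hull X \<longleftrightarrow>
    (\<forall>p M. complex_polynomial p \<longrightarrow> (\<forall>x\<in>X. cmod (p x) \<le> M) \<longrightarrow> cmod (p z) \<le> M)"
proof -
  have upper: "cmod (p x) \<le> (SUP x\<in>X. cmod (p x))" if "complex_polynomial p" "x \<in> X" for p x
  proof -
    have "compact ((\<lambda>x. cmod (p x)) ` X)"
      by (intro compact_continuous_image assms continuous_on_norm complex_polynomial_continuous_on that)
    then show ?thesis
      using that(2) by (intro cSUP_upper) (auto simp: compact_imp_bounded bounded_imp_bdd_above)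
  qed
  have least: "(SUP x\<in>X. cmod (p x)) \<le> M" if "\<forall>x\<in>X. cmod (p x) \<le> M" for p :: "complex ^ 'n \<Rightarrow> complex" and M
    using that assms(2) by (intro cSUP_least) auto
  show ?thesis
    unfolding polynomial_hull_def using upper least by (auto intro: order_trans)
qed

lemma subset_polynomial_hull: "compact X \<Longrightarrow> X \<subseteq> polynomial_hull X"
  using mem_polynomial_hull_iff[of X] by (cases "X = {}") (simp, blast)

text \<open>
  The supremum over the empty set is some fixed real number, and a constant polynomial exceeds it.
\<close>

lemma polynomial_hull_empty: "polynomial_hull {} = {}"
proof -
  have "\<not> cmod (complex_of_real (\<bar>Sup {}\<bar> + 1)) \<le> Sup {}"
    unfolding norm_of_real by linarith
  then show ?thesis
    unfolding polynomial_hull_def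
    using complex_polynomial_const[of "complex_of_real (\<bar>Sup {}\<bar> + 1)"] by force
qed

lemma closed_polynomial_hull: "closed (polynomial_hull X)"
proof -
  have eq: "polynomial_hull X = (\<Inter>p\<in>Collect complex_polynomial. {z. cmod (p z) \<le> (SUP x\<in>X. cmod (p x))})"
    unfolding polynomial_hull_def by blast
  show ?thesis unfolding eq
    by (intro closed_INT ballI closed_Collect_le continuous_intros complex_polynomial_continuous_on) auto
qed

lemma polynomial_hull_coord_bounded:
  assumes "compact X"
  obtains R where "R > 0" "\<And>z i. z \<in> polynomial_hull X \<Longrightarrow> cmod (z $ i) \<le> R"
proof (cases "X = {}")
  case True
  then show ?thesis using that[of 1] by (simp add: polynomial_hull_empty)
next
  case False
  obtain R where R: "R > 0" "\<And>x. x \<in> X \<Longrightarrow> norm x \<le> R"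
    using assms compact_imp_bounded bounded_pos by metis
  have "cmod (z $ i) \<le> R" if "z \<in> polynomial_hull X" for z i
  proof -
    have "cmod (x $ i) \<le> R" if "x \<in> X" for x
      using R(2)[OF that] Finite_Cartesian_Product.norm_nth_le[of x i] by linarith
    then show ?thesis
      using that complex_polynomial_coord[of i] unfolding mem_polynomial_hull_iff[OF assms False]
      by blast
  qed
  then show ?thesis using that R(1) by blast
qed

lemma compact_polynomial_hull:
  assumes "compact X"
  shows "compact (polynomial_hull X)"
proof -
  obtain R where R: "\<And>z i. z \<in> polynomial_hull X \<Longrightarrow> cmod (z $ i) \<le> R"
    using polynomial_hull_coord_bounded[OF assms] by metis
  have "norm z \<le> (\<Sum>i\<in>(UNIV::'a set). R)" if "z \<in> polynomial_hull X" for z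
  proof -
    have "norm z \<le> (\<Sum>i\<in>UNIV. cmod (z $ i))"
      unfolding norm_vec_def by (rule L2_set_le_sum) simp
    also have "\<dots> \<le> (\<Sum>i\<in>(UNIV::'a set). R)"
      by (intro sum_mono R that)
    finally show ?thesis .
  qed
  then have "bounded (polynomial_hull X)"
    unfolding bounded_iff by blast
  then show ?thesis
    using closed_polynomial_hull compact_eq_bounded_closed by blast
qed

section \<open>Adjoining a square root to the last coordinate\<close>

definition append_coord :: "complex ^ 'n \<Rightarrow> complex \<Rightarrow> complex ^ ('n::finite) option" where
  "append_coord z w = (\<chi> i. case i of None \<Rightarrow> w | Some l \<Rightarrow> z $ l)"

lemma append_coord_nth [simp]:
  "append_coord z w $ None = w" "append_coord z w $ Some l = z $ l"
  by (simp_all add: append_coord_def)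

lemma first_coords_append_coord [simp]: "first_coords (append_coord z w) = z"
  by (simp add: first_coords_def vec_eq_iff)

lemma append_coord_first_coords [simp]: "append_coord (first_coords v) (v $ None) = v"
  by (auto simp: append_coord_def first_coords_def vec_eq_iff split: option.split)

lemma continuous_on_append_coord [continuous_intros]:
  assumes "continuous_on S f" "continuous_on S g"
  shows "continuous_on S (\<lambda>x. append_coord (f x) (g x))"
  unfolding append_coord_def
proof (rule continuous_on_vec_lambda)
  show "continuous_on S (\<lambda>x. case i of None \<Rightarrow> g x | Some l \<Rightarrow> f x $ l)" for i
    using assms by (cases i) (auto intro!: continuous_intros)
qed

lemma complex_polynomial_first_coords:
  "complex_polynomial d \<Longrightarrow> complex_polynomial (\<lambda>v. d (first_coords v))"
  by (rule complex_polynomial_compose) (auto simp: first_coords_def intro: complex_polynomial_coord)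

lemma complex_polynomial_append_coord:
  assumes "complex_polynomial q"
  shows "complex_polynomial (\<lambda>z. q (append_coord z k))"
proof (rule complex_polynomial_compose[OF assms])
  show "complex_polynomial (\<lambda>z. append_coord z k $ i)" for i
    by (cases i) (auto intro: complex_polynomial_intros)
qed

text \<open>
  Replacing the last coordinate \<open>w\<close> by \<open>w + s\<close> with \<open>s\<^sup>2 = d z\<close> turns a polynomial into \<open>A + s B\<close>: even powers
  of \<open>s\<close> are polynomials in \<open>z\<close>. Since \<open>- s\<close> is a root of \<open>d z\<close> too, the two values for \<open>w + s\<close> and \<open>w - s\<close>
  have the sum \<open>2 A\<close> and the product \<open>A\<^sup>2 - d B\<^sup>2\<close>, which are polynomials in \<open>(z, w)\<close>.
\<close>

lemma split_adjoined_root: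
  fixes q :: "complex ^ ('n::finite) option \<Rightarrow> complex"
  assumes "complex_polynomial q" "complex_polynomial d"
  obtains A B where "complex_polynomial A" "complex_polynomial B"
    "\<And>z w s. s\<^sup>2 = d z \<Longrightarrow> q (append_coord z (w + s)) = A (append_coord z w) + s * B (append_coord z w)"
proof -
  have "\<exists>A B. complex_polynomial A \<and> complex_polynomial B \<and> (\<forall>z w s. s\<^sup>2 = d z \<longrightarrow>
      q (append_coord z (w + s)) = A (append_coord z w) + s * B (append_coord z w))"
    using assms(1)
  proof (induction rule: complex_polynomial_induct)
    case (const k)
    show ?case
      by (rule exI[of _ "\<lambda>_. k"], rule exI[of _ "\<lambda>_. 0"]) (simp add: complex_polynomial_const)
  next
    case (coord i)
    show ?case
    proof (cases i)
      case None
      show ?thesis unfolding None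
        by (rule exI[of _ "\<lambda>v. v $ None"], rule exI[of _ "\<lambda>_. 1"])
          (simp add: complex_polynomial_const complex_polynomial_coord)
    next
      case (Some l)
      show ?thesis unfolding Some
        by (rule exI[of _ "\<lambda>v. v $ Some l"], rule exI[of _ "\<lambda>_. 0"])
          (simp add: complex_polynomial_const complex_polynomial_coord)
    qed
  next
    case (add p q)
    then obtain A B C D where pq:
      "complex_polynomial A" "complex_polynomial B" "complex_polynomial C" "complex_polynomial D"
      and *:
      "\<And>z w s. s\<^sup>2 = d z \<Longrightarrow> p (append_coord z (w + s)) = A (append_coord z w) + s * B (append_coord z w)"
      "\<And>z w s. s\<^sup>2 = d z \<Longrightarrow> q (append_coord z (w + s)) = C (append_coord z w) + s * D (append_coord z w)"
      by (elim exE conjE) (rule that; simp)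
    have *: "p (append_coord z (w + s)) + q (append_coord z (w + s)) = (A v + C v) + s * (B v + D v)"
      if "s\<^sup>2 = d z" "v = append_coord z w" for z w s v
      unfolding *[OF that(1)] that(2) by (simp add: algebra_simps)
    show ?case
      by (rule exI[of _ "\<lambda>v. A v + C v"], rule exI[of _ "\<lambda>v. B v + D v"])
        (simp add: * complex_polynomial_add pq)
  next
    case (mult p q)
    then obtain A B C D where pq:
      "complex_polynomial A" "complex_polynomial B" "complex_polynomial C" "complex_polynomial D"
      and *:
      "\<And>z w s. s\<^sup>2 = d z \<Longrightarrow> p (append_coord z (w + s)) = A (append_coord z w) + s * B (append_coord z w)"
      "\<And>z w s. s\<^sup>2 = d z \<Longrightarrow> q (append_coord z (w + s)) = C (append_coord z w) + s * D (append_coord z w)"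
      by (elim exE conjE) (rule that; simp)
    have *: "p (append_coord z (w + s)) * q (append_coord z (w + s))
        = (A v * C v + d (first_coords v) * (B v * D v)) + s * (A v * D v + B v * C v)"
      if "s\<^sup>2 = d z" "v = append_coord z w" for z w s v
      unfolding *[OF that(1)] that(2) first_coords_append_coord that(1)[symmetric]
      by (simp add: algebra_simps power2_eq_square)
    show ?case
      by (rule exI[of _ "\<lambda>v. A v * C v + d (first_coords v) * (B v * D v)"],
          rule exI[of _ "\<lambda>v. A v * D v + B v * C v"])
        (simp add: * complex_polynomial_add complex_polynomial_mult
          complex_polynomial_first_coords[OF assms(2)] pq)
  qed
  then obtain A B where "complex_polynomial A" "complex_polynomial B" "\<forall>z w s. s\<^sup>2 = d z \<longrightarrow>
      q (append_coord z (w + s)) = A (append_coord z w) + s * B (append_coord z w)"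
    by (elim exE conjE)
  then show ?thesis by (intro that[of A B]) simp_all
qed

section \<open>Finite sums of square roots\<close>

text \<open>
  The values of \<open>\<pm>\<surd>d\<^sub>0 \<pm> \<dots> \<pm> \<surd>d\<^sub>n\<^sub>-\<^sub>1\<close> at \<open>z\<close>. The recursion involves \<open>d\<^sub>j\<close> for \<open>j < n\<close> only, so that the later
  polynomials may be chosen depending on these sets.
\<close>

primrec root_sums :: "(nat \<Rightarrow> complex ^ 'n \<Rightarrow> complex) \<Rightarrow> nat \<Rightarrow> complex ^ 'n \<Rightarrow> complex set" where
  "root_sums d 0 z = {0}"
| "root_sums d (Suc n) z = {t + s | t s. t \<in> root_sums d n z \<and> s\<^sup>2 = d n z}"

lemma root_sums_SucI:
  assumes "t \<in> root_sums d n z" "s\<^sup>2 = d n z"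
  shows "t + s \<in> root_sums d (Suc n) z" "t - s \<in> root_sums d (Suc n) z"
proof -
  have plus: "t + r \<in> root_sums d (Suc n) z" if "r\<^sup>2 = d n z" for r
    using assms(1) that by auto
  show "t + s \<in> root_sums d (Suc n) z" "t - s \<in> root_sums d (Suc n) z"
    using plus[of s] plus[of "- s"] assms(2) by simp_all
qed

lemma obtain_complex_sqrt:
  obtains s where "s\<^sup>2 = (a :: complex)"
  using power2_csqrt by blast

lemma root_sums_sumI:
  "(\<And>j. j < n \<Longrightarrow> (s j)\<^sup>2 = d j z) \<Longrightarrow> (\<Sum>j<n. s j) \<in> root_sums d n z"
  by (induction n) auto

text \<open>
  The roots \<open>s j\<close> with \<open>j \<ge> n\<close> are chosen arbitrarily; a full sequence can be continued to a limit of the series.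
\<close>

lemma root_sumsE:
  assumes "t \<in> root_sums d n z"
  obtains s where "\<And>j. (s j)\<^sup>2 = d j z" "t = (\<Sum>j<n. s j)"
proof -
  have "\<exists>s. (\<forall>j. (s j)\<^sup>2 = d j z) \<and> t = (\<Sum>j<n. s j)"
    using assms
  proof (induction n arbitrary: t)
    case 0
    have "\<forall>j. (csqrt (d j z))\<^sup>2 = d j z" by simp
    then show ?case using 0 by (auto intro!: exI[of _ "\<lambda>j. csqrt (d j z)"])
  next
    case (Suc n)
    then obtain t' r where t: "t = t' + r" "t' \<in> root_sums d n z" "r\<^sup>2 = d n z" by auto
    obtain s where s: "\<forall>j. (s j)\<^sup>2 = d j z" "t' = (\<Sum>j<n. s j)" using Suc.IH[OF t(2)] by blast
    have "(\<Sum>j<n. (s(n := r)) j) = (\<Sum>j<n. s j)" by (intro sum.cong) auto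
    with s t show ?case by (intro exI[of _ "s(n := r)"]) auto
  qed
  then show ?thesis using that by blast
qed

lemma root_sums_nonempty: "root_sums d n z \<noteq> {}"
  using root_sums_sumI[of n "\<lambda>j. csqrt (d j z)" d z] by auto

lemma root_sums_cong:
  "(\<And>j. j < n \<Longrightarrow> d j = d' j) \<Longrightarrow> root_sums d n z = root_sums d' n z"
  by (induction n) auto

lemma finite_root_sums: "finite (root_sums d n z)"
  and card_root_sums_le: "card (root_sums d n z) \<le> 2 ^ n"
proof (induction n)
  case 0
  case 1 show ?case by simp
next
  case 0
  case 2 show ?case by simp
next
  case (Suc n)
  obtain r where r: "r\<^sup>2 = d n z" by (rule obtain_complex_sqrt)
  have eq: "root_sums d (Suc n) z = (\<lambda>t. t + r) ` root_sums d n z \<union> (\<lambda>t. t - r) ` root_sums d n z" (is "_ = ?A \<union> ?B")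
  proof (intro equalityI subsetI)
    fix u assume "u \<in> root_sums d (Suc n) z"
    then obtain t s where "u = t + s" "t \<in> root_sums d n z" "s\<^sup>2 = r\<^sup>2" using r by auto
    then show "u \<in> ?A \<union> ?B" by (auto simp: power2_eq_iff)
  next
    show "u \<in> root_sums d (Suc n) z" if "u \<in> ?A \<union> ?B" for u
      using that root_sums_SucI[of _ d n z r] r by blast
  qed
  have "card ?A \<le> 2 ^ n" "card ?B \<le> 2 ^ n"
    using Suc.IH card_image_le order_trans by blast+
  then have "card (?A \<union> ?B) \<le> 2 ^ Suc n"
    using card_Un_le[of ?A ?B] by simp
  then show "finite (root_sums d (Suc n) z)" "card (root_sums d (Suc n) z) \<le> 2 ^ Suc n"
    unfolding eq using Suc.IH by auto
qed

lemma le_of_powers_le: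
  fixes a C M :: real
  assumes "0 \<le> M" "\<And>k. a ^ k \<le> C * M ^ k"
  shows "a \<le> M"
proof (rule ccontr)
  assume "\<not> a \<le> M"
  then have "M < a" by simp
  show False
  proof (cases "M = 0")
    case True
    then show False using assms(2)[of 1] \<open>M < a\<close> by simp
  next
    case False
    then have "1 < a / M" using \<open>M < a\<close> assms(1) by simp
    then obtain k where "C < (a / M) ^ k" using real_arch_pow by blast
    then show False using assms(2)[of k] False assms(1)
      by (simp add: power_divide field_simps)
  qed
qed

text \<open>
  The number \<open>a\<close> is a root of \<open>x\<^sup>2 - (a + b) x + a b\<close>. The factor \<open>3\<close> is not optimal; it disappears
  when the bound is applied to all powers of a polynomial, by the lemma before.
\<close>

lemma norm_le_of_sum_prod_le:
  fixes a b :: complex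
  assumes "cmod (a + b) \<le> 2 * M" "cmod (a * b) \<le> M\<^sup>2" "0 \<le> M"
  shows "cmod a \<le> 3 * M"
proof (rule ccontr)
  assume "\<not> cmod a \<le> 3 * M"
  then have a: "cmod a > 3 * M" by simp
  have "a\<^sup>2 = a * (a + b) - a * b" by (simp add: algebra_simps power2_eq_square)
  then have "(cmod a)\<^sup>2 \<le> cmod a * cmod (a + b) + cmod (a * b)"
    by (metis norm_mult norm_power norm_triangle_ineq4)
  also have "\<dots> \<le> cmod a * (2 * M) + M\<^sup>2"
    using assms by (intro add_mono mult_left_mono) auto
  finally have "cmod a * (cmod a - 2 * M) \<le> M\<^sup>2" by (simp add: algebra_simps power2_eq_square)
  moreover have "cmod a * (cmod a - 2 * M) \<ge> cmod a * M"
    using a by (intro mult_left_mono) auto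
  moreover have "cmod a * M \<ge> 3 * M * M" using a assms(3) by (intro mult_right_mono) auto
  ultimately have "3 * (M * M) \<le> M * M" by (simp add: power2_eq_square)
  then have "M = 0" by (auto simp: mult_le_0_iff)
  then show False using \<open>cmod a * (cmod a - 2 * M) \<le> M\<^sup>2\<close> a by (auto simp: power2_eq_square mult_le_0_iff)
qed

text \<open>
  A maximum principle for polynomials on the graph of the partial sums, from \<open>X\<close> to its hull. In the
  induction step the trace and the norm over the last root are polynomials on the previous stage, where
  the induction hypothesis bounds them. This bounds the polynomial up to the factor \<open>3\<close>, and passing to
  its powers removes the factor.
\<close>

lemma root_sums_hull_bound:
  fixes X :: "(complex ^ 'n) set"
  assumes "compact X" "X \<noteq> {}" and d: "\<And>j. complex_polynomial (d j)"
    and z: "z \<in> polynomial_hull X"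
  shows "complex_polynomial q \<Longrightarrow> t \<in> root_sums d n z \<Longrightarrow>
    (\<And>x t. x \<in> X \<Longrightarrow> t \<in> root_sums d n x \<Longrightarrow> cmod (q (append_coord x t)) \<le> M) \<Longrightarrow>
    cmod (q (append_coord z t)) \<le> M"
proof (induction n arbitrary: q t M)
  case 0
  then show ?case
    using z complex_polynomial_append_coord[OF 0(1), of 0] unfolding mem_polynomial_hull_iff[OF assms(1,2)]
    by auto
next
  case (Suc n)
  from Suc.prems(2) obtain \<tau> s where t: "t = \<tau> + s" and \<tau>: "\<tau> \<in> root_sums d n z" and s: "s\<^sup>2 = d n z"
    by auto
  have M0: "0 \<le> M"
    using assms(2) root_sums_nonempty[of d "Suc n"] Suc.prems(3) by (meson all_not_in_conv norm_ge_zero order_trans)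
  have bound3: "cmod (p (append_coord z t)) \<le> 3 * L"
    if p: "complex_polynomial p" and L: "0 \<le> L"
      and bd: "\<And>x u. x \<in> X \<Longrightarrow> u \<in> root_sums d (Suc n) x \<Longrightarrow> cmod (p (append_coord x u)) \<le> L" for p L
  proof -
    obtain A B where A: "complex_polynomial A" and B: "complex_polynomial B"
      and AB: "\<And>z w s. s\<^sup>2 = d n z \<Longrightarrow> p (append_coord z (w + s)) = A (append_coord z w) + s * B (append_coord z w)"
      using split_adjoined_root[OF p d] by metis
    \<comment> \<open>trace and norm of \<open>p\<close> over the two roots of \<open>d n\<close>\<close>
    let ?T = "\<lambda>v. 2 * A v" and ?N = "\<lambda>v. A v * A v - d n (first_coords v) * (B v * B v)"
    have T: "p (append_coord x (u + r)) + p (append_coord x (u - r)) = ?T (append_coord x u)"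
     and N: "p (append_coord x (u + r)) * p (append_coord x (u - r)) = ?N (append_coord x u)"
      if "r\<^sup>2 = d n x" for x u r
    proof -
      have *: "p (append_coord x (u + r)) = A (append_coord x u) + r * B (append_coord x u)"
        "p (append_coord x (u - r)) = A (append_coord x u) - r * B (append_coord x u)"
        using AB[of r x u] AB[of "- r" x u] that by simp_all
      show "p (append_coord x (u + r)) + p (append_coord x (u - r)) = ?T (append_coord x u)"
        unfolding * by simp
      show "p (append_coord x (u + r)) * p (append_coord x (u - r)) = ?N (append_coord x u)"
        unfolding * first_coords_append_coord that[symmetric]
        by (simp add: algebra_simps power2_eq_square)
    qed
    have bds: "cmod (?T (append_coord x u)) \<le> 2 * L \<and> cmod (?N (append_coord x u)) \<le> L\<^sup>2"
      if "x \<in> X" "u \<in> root_sums d n x" for x u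
    proof -
      obtain r where r: "r\<^sup>2 = d n x" by (rule obtain_complex_sqrt)
      have "cmod (p (append_coord x (u + r))) \<le> L" "cmod (p (append_coord x (u - r))) \<le> L"
        using bd[OF that(1)] root_sums_SucI[OF that(2) r] by blast+
      then show ?thesis
        unfolding T[OF r, symmetric] N[OF r, symmetric] norm_mult[of "p _"] power2_eq_square
        using norm_triangle_ineq[of "p (append_coord x (u + r))" "p (append_coord x (u - r))"] L
        by (auto intro: mult_mono)
    qed
    have "complex_polynomial ?T" "complex_polynomial ?N"
      by (intro complex_polynomial_diff complex_polynomial_mult complex_polynomial_const A B
          complex_polynomial_first_coords d)+
    then have "cmod (?T (append_coord z \<tau>)) \<le> 2 * L" "cmod (?N (append_coord z \<tau>)) \<le> L\<^sup>2"
      using Suc.IH[OF _ \<tau>, of ?T "2 * L"] Suc.IH[OF _ \<tau>, of ?N "L\<^sup>2"] bds by blast+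
    then show ?thesis
      unfolding t using T[OF s, of \<tau>] N[OF s, of \<tau>] L by (intro norm_le_of_sum_prod_le[of _ "p (append_coord z (\<tau> - s))"]) simp_all
  qed
  \<comment> \<open>the factor \<open>3\<close> stays the same for all powers of \<open>q\<close>, so it can be removed\<close>
  have "cmod (q (append_coord z t)) ^ k \<le> 3 * M ^ k" for k
    using bound3[of "\<lambda>v. q v ^ k" "M ^ k"] complex_polynomial_power[OF Suc.prems(1), of k] Suc.prems(3) M0
    by (simp add: norm_power power_mono)
  then show ?case using le_of_powers_le[OF M0] by blast
qed

text \<open>
  The polynomial \<open>Q\<close> is the product of \<open>w - t\<close> over the \<open>2\<^sup>n\<close> sign choices for the partial sum \<open>t\<close>, obtained by
  taking the norm over one root after the other. Only its size matters: it is large where \<open>w\<close> is far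
  from all partial sums, and small where \<open>w\<close> is close to one of them.
\<close>

lemma root_sums_eliminant:
  fixes d :: "nat \<Rightarrow> complex ^ 'n \<Rightarrow> complex"
  assumes d: "\<And>j. complex_polynomial (d j)"
  obtains Q where "complex_polynomial Q"
    "\<And>z w \<delta>. 0 \<le> \<delta> \<Longrightarrow> (\<And>t. t \<in> root_sums d n z \<Longrightarrow> \<delta> \<le> cmod (w - t)) \<Longrightarrow>
       \<delta> ^ 2 ^ n \<le> cmod (Q (append_coord z w))"
    "\<And>z w t \<tau> K. t \<in> root_sums d n z \<Longrightarrow> cmod (w - t) \<le> \<tau> \<Longrightarrow>
       (\<And>t. t \<in> root_sums d n z \<Longrightarrow> cmod (w - t) \<le> K) \<Longrightarrow>
       cmod (Q (append_coord z w)) \<le> \<tau> * K ^ (2 ^ n - 1)"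
proof -
  have "\<exists>Q. complex_polynomial Q \<and>
    (\<forall>z w \<delta>. 0 \<le> \<delta> \<longrightarrow> (\<forall>t \<in> root_sums d n z. \<delta> \<le> cmod (w - t)) \<longrightarrow>
       \<delta> ^ 2 ^ n \<le> cmod (Q (append_coord z w))) \<and>
    (\<forall>z w t \<tau> K. t \<in> root_sums d n z \<longrightarrow> cmod (w - t) \<le> \<tau> \<longrightarrow>
       (\<forall>t \<in> root_sums d n z. cmod (w - t) \<le> K) \<longrightarrow>
       cmod (Q (append_coord z w)) \<le> \<tau> * K ^ (2 ^ n - 1))" (is "\<exists>Q. ?P Q n")
  proof (induction n)
    case 0
    show ?case by (intro exI[of _ "\<lambda>v. v $ None"]) (auto intro: complex_polynomial_coord)
  next
    case (Suc n)
    then obtain Q where PQ: "?P Q n" by blast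
    then have Q: "complex_polynomial Q" by blast
    have lower: "\<delta> ^ 2 ^ n \<le> cmod (Q (append_coord z w))"
      if "0 \<le> \<delta>" "\<And>t. t \<in> root_sums d n z \<Longrightarrow> \<delta> \<le> cmod (w - t)" for z w \<delta>
      using PQ that by simp
    have upper: "cmod (Q (append_coord z w)) \<le> \<tau> * K ^ (2 ^ n - 1)"
      if "t \<in> root_sums d n z" "cmod (w - t) \<le> \<tau>"
        "\<And>t. t \<in> root_sums d n z \<Longrightarrow> cmod (w - t) \<le> K" for z w t \<tau> K
      using PQ that by simp
    obtain A B where A: "complex_polynomial A" and B: "complex_polynomial B"
      and AB: "\<And>z w s. s\<^sup>2 = d n z \<Longrightarrow> Q (append_coord z (w + s)) = A (append_coord z w) + s * B (append_coord z w)"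
      using split_adjoined_root[OF Q d] by metis
    define Q' where "Q' = (\<lambda>v. A v * A v - d n (first_coords v) * (B v * B v))"
    have Q': "complex_polynomial Q'"
      unfolding Q'_def by (intro complex_polynomial_diff complex_polynomial_intros complex_polynomial_first_coords A B d)
    have Q'_eq: "Q' (append_coord z w) = Q (append_coord z (w + s)) * Q (append_coord z (w - s))"
      if "s\<^sup>2 = d n z" for z w s
    proof -
      have *: "Q (append_coord z (w + s)) = A (append_coord z w) + s * B (append_coord z w)"
        "Q (append_coord z (w - s)) = A (append_coord z w) - s * B (append_coord z w)"
        using AB[of s z w] AB[of "- s" z w] that by simp_all
      show ?thesis
        unfolding * Q'_def first_coords_append_coord that[symmetric]
        by (simp add: algebra_simps power2_eq_square)
    qed
    have "\<delta> ^ 2 ^ Suc n \<le> cmod (Q' (append_coord z w))"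
      if "0 \<le> \<delta>" "\<forall>t \<in> root_sums d (Suc n) z. \<delta> \<le> cmod (w - t)" for z w \<delta>
    proof -
      obtain s where s: "s\<^sup>2 = d n z" by (rule obtain_complex_sqrt)
      have "\<delta> \<le> cmod (w + s - t)" "\<delta> \<le> cmod (w - s - t)" if "t \<in> root_sums d n z" for t
      proof -
        have "t - s \<in> root_sums d (Suc n) z" "t + s \<in> root_sums d (Suc n) z"
          using root_sums_SucI[OF that s] by blast+
        then have "\<delta> \<le> cmod (w - (t - s))" "\<delta> \<le> cmod (w - (t + s))" using \<open>\<forall>t \<in> _. _\<close> by blast+
        then show "\<delta> \<le> cmod (w + s - t)" "\<delta> \<le> cmod (w - s - t)" by (simp_all add: algebra_simps)
      qed
      then have "\<delta> ^ 2 ^ n \<le> cmod (Q (append_coord z (w + s)))" "\<delta> ^ 2 ^ n \<le> cmod (Q (append_coord z (w - s)))"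
        using lower[OF that(1)] by blast+
      then have "\<delta> ^ 2 ^ n * \<delta> ^ 2 ^ n \<le> cmod (Q (append_coord z (w + s))) * cmod (Q (append_coord z (w - s)))"
        using that(1) by (intro mult_mono) auto
      then show ?thesis unfolding Q'_eq[OF s] norm_mult by (simp add: mult_2 power_add)
    qed
    moreover have "cmod (Q' (append_coord z w)) \<le> \<tau> * K ^ (2 ^ Suc n - 1)"
      if t: "t \<in> root_sums d (Suc n) z" and \<tau>: "cmod (w - t) \<le> \<tau>"
        and K: "\<forall>t \<in> root_sums d (Suc n) z. cmod (w - t) \<le> K" for z w t \<tau> K
    proof -
      obtain u s where tu: "t = u + s" and u: "u \<in> root_sums d n z" and s: "s\<^sup>2 = d n z" using t by auto
      have K': "cmod (w + s - t) \<le> K" "cmod (w - s - t) \<le> K" if "t \<in> root_sums d n z" for t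
      proof -
        have "t - s \<in> root_sums d (Suc n) z" "t + s \<in> root_sums d (Suc n) z"
          using root_sums_SucI[OF that s] by blast+
        then have "cmod (w - (t - s)) \<le> K" "cmod (w - (t + s)) \<le> K" using K by blast+
        then show "cmod (w + s - t) \<le> K" "cmod (w - s - t) \<le> K" by (simp_all add: algebra_simps)
      qed
      have "cmod (Q (append_coord z (w - s))) \<le> \<tau> * K ^ (2 ^ n - 1)"
        using K' \<tau> by (intro upper[OF u]) (auto simp: tu algebra_simps)
      moreover have "cmod (Q (append_coord z (w + s))) \<le> K * K ^ (2 ^ n - 1)"
        using K' by (intro upper[OF u]) (use u in auto)
      moreover have "0 \<le> K" using K'[OF u] norm_ge_zero order_trans by blast
      ultimately have "cmod (Q (append_coord z (w + s))) * cmod (Q (append_coord z (w - s)))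
          \<le> (K * K ^ (2 ^ n - 1)) * (\<tau> * K ^ (2 ^ n - 1))"
        by (intro mult_mono) auto
      moreover have "2 ^ Suc n - 1 = (1 + (2 ^ n - 1)) + (2 ^ n - 1 :: nat)"
        using one_le_power[of "2::nat" n] by simp
      ultimately show ?thesis
        unfolding Q'_eq[OF s] norm_mult by (simp only: power_add) (simp add: mult_ac)
    qed
    ultimately show ?case using Q' by (intro exI[of _ Q']) simp
  qed
  then obtain Q where Q: "?P Q n" by blast
  show ?thesis
    using Q by (intro that[of Q]) simp_all
qed

section \<open>Infinite sums of square roots and the hull of their graph\<close>

definition limit_root_sums :: "(nat \<Rightarrow> complex ^ 'n \<Rightarrow> complex) \<Rightarrow> complex ^ 'n \<Rightarrow> complex set" where
  "limit_root_sums d z = {(\<Sum>j. s j) | s. \<forall>j. (s j)\<^sup>2 = d j z}"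

definition root_graph :: "(nat \<Rightarrow> complex ^ ('n::finite) \<Rightarrow> complex) \<Rightarrow> (complex ^ 'n) set \<Rightarrow> (complex ^ 'n option) set" where
  "root_graph d K = {append_coord z w | z w. z \<in> K \<and> w \<in> limit_root_sums d z}"

lemma limit_root_sums_nonempty: "limit_root_sums d z \<noteq> {}"
proof -
  have "(\<Sum>j. csqrt (d j z)) \<in> limit_root_sums d z"
    unfolding limit_root_sums_def by (rule CollectI, rule exI[of _ "\<lambda>j. csqrt (d j z)"]) simp
  then show ?thesis by blast
qed

lemma mem_root_graph_iff:
  "v \<in> root_graph d K \<longleftrightarrow> first_coords v \<in> K \<and> v $ None \<in> limit_root_sums d (first_coords v)"
proof
  assume "v \<in> root_graph d K"
  then show "first_coords v \<in> K \<and> v $ None \<in> limit_root_sums d (first_coords v)"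
    by (auto simp: root_graph_def)
next
  assume "first_coords v \<in> K \<and> v $ None \<in> limit_root_sums d (first_coords v)"
  then show "v \<in> root_graph d K"
    unfolding root_graph_def by (auto intro!: exI[of _ "first_coords v"] exI[of _ "v $ None"])
qed

lemma first_coords_root_graph: "first_coords ` root_graph d K = K"
proof
  show "K \<subseteq> first_coords ` root_graph d K"
  proof
    fix z assume "z \<in> K"
    moreover obtain w where "w \<in> limit_root_sums d z" using limit_root_sums_nonempty by blast
    ultimately have "append_coord z w \<in> root_graph d K" by (simp add: mem_root_graph_iff)
    then show "z \<in> first_coords ` root_graph d K" by (rule rev_image_eqI) simp
  qed
qed (auto simp: mem_root_graph_iff)

text \<open>
  Subadditivity of length. It is applied to distances from a point of a fibre, to show that a connected
  subset of the fibre has only one point.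
\<close>

lemma interval_cover_length:
  fixes D r :: real
  assumes "finite F" "{0..D} \<subseteq> (\<Union>t\<in>F. {f t - r..f t + r})" "0 \<le> r"
  shows "D \<le> real (card F) * (2 * r)"
proof (cases "0 \<le> D")
  case True
  have "emeasure lborel {0..D} \<le> emeasure lborel (\<Union>t\<in>F. {f t - r..f t + r})"
    using assms(1) by (intro emeasure_mono assms) (auto intro!: sets.finite_UN)
  also have "\<dots> \<le> (\<Sum>t\<in>F. emeasure lborel {f t - r..f t + r})"
    using assms(1) by (intro emeasure_subadditive_finite) auto
  also have "\<dots> = (\<Sum>t\<in>F. ennreal (2 * r))"
    using assms(3) by simp
  also have "\<dots> = ennreal (real (card F) * (2 * r))"
    using assms(3) by (simp add: ennreal_mult ennreal_of_nat_eq_real_of_nat)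
  finally show ?thesis using True assms(3) by simp
next
  case False
  then show ?thesis using assms(3) by (smt (verit) mult_nonneg_nonneg of_nat_0_le_iff)
qed

lemma nonpos_if_le_inverse_nat:
  fixes x :: real
  assumes "\<And>n::nat. x \<le> 2 / (real n + 2)"
  shows "x \<le> 0"
proof (rule ccontr)
  assume "\<not> x \<le> 0"
  obtain n :: nat where "2 / x < real n" using reals_Archimedean2 by blast
  then have "2 < x * real n" using \<open>\<not> x \<le> 0\<close> by (simp add: field_simps)
  moreover have "x * (real n + 2) \<le> 2" using assms[of n] by (simp add: field_simps)
  ultimately show False using \<open>\<not> x \<le> 0\<close> by (simp add: algebra_simps)
qed

text \<open>
  The number \<open>c j\<close> bounds the roots of \<open>d j\<close> on the hull of \<open>X\<close>. The rate of decrease of the tails serves two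
  purposes: the \<open>2 ^ n\<close>-th root of the \<open>n\<close>-th tail tends to zero, and so does \<open>2 ^ n\<close> times the \<open>n\<close>-th tail.
  At \<open>n = 0\<close> it bounds all sums by \<open>1 / 2\<close>, so that any two of them differ by at most \<open>1\<close>.
\<close>

locale small_roots =
  fixes d :: "nat \<Rightarrow> complex ^ ('n::finite) \<Rightarrow> complex" and c :: "nat \<Rightarrow> real" and X :: "(complex ^ 'n) set"
  assumes compact_X: "compact X" and X_nonempty: "X \<noteq> {}"
    and polynomial_d: "complex_polynomial (d j)"
    and c_nonneg: "0 \<le> c j" and summable_c: "summable c"
    and d_bound: "z \<in> polynomial_hull X \<Longrightarrow> cmod (d j z) \<le> (c j)\<^sup>2"
    and tail_le: "(\<Sum>j. c (j + n)) \<le> (1 / (real n + 2)) ^ 2 ^ n"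
begin

abbreviation tail :: "nat \<Rightarrow> real" where
  "tail n \<equiv> \<Sum>j. c (j + n)"

lemma tail_nonneg: "0 \<le> tail n"
  using c_nonneg summable_c by (intro suminf_nonneg) (auto simp: summable_iff_shift)

lemma tail_le_inverse: "tail n \<le> 1 / (real n + 2)"
proof -
  have "(1 / (real n + 2)) ^ 2 ^ n \<le> (1 / (real n + 2)) ^ 1"
    by (intro power_decreasing) (auto simp: Suc_leI)
  then show ?thesis using tail_le[of n] by simp
qed

lemma norm_root_le:
  assumes "z \<in> polynomial_hull X" "s\<^sup>2 = d j z"
  shows "cmod s \<le> c j"
proof -
  have "(cmod s)\<^sup>2 \<le> (c j)\<^sup>2"
    using d_bound[OF assms(1), of j] assms(2) by (metis norm_power)
  then show ?thesis using c_nonneg by (rule power2_le_imp_le)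
qed

lemma limit_near_partial_sum:
  assumes "z \<in> polynomial_hull X" "\<And>j. (s j)\<^sup>2 = d j z"
  shows "cmod ((\<Sum>j. s j) - (\<Sum>j<n. s j)) \<le> tail n"
proof -
  have le: "cmod (s j) \<le> c j" for j using norm_root_le assms by blast
  then have "summable s" using summable_c by (metis summable_comparison_test')
  then have "(\<Sum>j. s j) - (\<Sum>j<n. s j) = (\<Sum>j. s (j + n))"
    by (simp add: suminf_minus_initial_segment)
  also have "cmod \<dots> \<le> tail n"
    using le summable_c by (intro norm_suminf_le) (auto simp: summable_iff_shift)
  finally show ?thesis .
qed

lemma limit_near_root_sums:
  assumes "z \<in> polynomial_hull X" "w \<in> limit_root_sums d z"
  obtains t where "t \<in> root_sums d n z" "cmod (w - t) \<le> tail n"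
proof -
  obtain s where s: "w = (\<Sum>j. s j)" "\<And>j. (s j)\<^sup>2 = d j z" using assms(2) by (auto simp: limit_root_sums_def)
  show ?thesis
    using limit_near_partial_sum[OF assms(1) s(2), of n] root_sums_sumI[of n s d z] s
    by (intro that[of "\<Sum>j<n. s j"]) auto
qed

lemma root_sums_near_limit:
  assumes "z \<in> polynomial_hull X" "t \<in> root_sums d n z"
  obtains w where "w \<in> limit_root_sums d z" "cmod (w - t) \<le> tail n"
proof -
  obtain s where s: "\<And>j. (s j)\<^sup>2 = d j z" "t = (\<Sum>j<n. s j)" using assms(2) by (rule root_sumsE) blast
  show ?thesis
    using limit_near_partial_sum[OF assms(1) s(1), of n] s
    by (intro that[of "\<Sum>j. s j"]) (auto simp: limit_root_sums_def)
qed

lemma norm_limit_root_sums_le: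
  assumes "z \<in> polynomial_hull X" "w \<in> limit_root_sums d z"
  shows "cmod w \<le> 1 / 2"
  using limit_near_root_sums[OF assms, of 0] tail_le[of 0] by fastforce

lemma norm_root_sums_le:
  assumes "z \<in> polynomial_hull X" "t \<in> root_sums d n z"
  shows "cmod t \<le> 1 / 2"
proof -
  obtain s where s: "\<And>j. (s j)\<^sup>2 = d j z" "t = (\<Sum>j<n. s j)" using assms(2) by (rule root_sumsE) blast
  have "cmod t \<le> (\<Sum>j<n. c j)"
    unfolding s(2) by (intro sum_norm_le norm_root_le[OF assms(1) s(1)])
  also have "\<dots> \<le> (\<Sum>j. c j)"
    using summable_c c_nonneg by (intro sum_le_suminf) auto
  finally show ?thesis using tail_le[of 0] by simp
qed

text \<open>
  The graph is the continuous image of the set of all pairs of a point \<open>z\<close> and a sequence of roots at \<open>z\<close>,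
  which is closed in a product of compact sets. The sum of the series is continuous there because it
  converges uniformly.
\<close>

lemma compact_root_graph:
  assumes "compact K" "K \<subseteq> polynomial_hull X"
  shows "compact (root_graph d K)"
proof -

  define \<Omega> where "\<Omega> = {p. fst p \<in> K \<and> (\<forall>j. (snd p j)\<^sup>2 = d j (fst p))}"
  have "compactin (product_topology (\<lambda>i::nat. euclidean) UNIV) (Pi\<^sub>E UNIV (\<lambda>j. cball (0::complex) (c j)))"
    unfolding compactin_PiE by simp
  then have "compact (Pi\<^sub>E UNIV (\<lambda>j. cball (0::complex) (c j)))"
    by (simp add: euclidean_product_topology)
  then have cp: "compact (K \<times> Pi\<^sub>E UNIV (\<lambda>j. cball (0::complex) (c j)))"
    using assms(1) by (rule compact_Times[rotated])
  have coord: "continuous_on S (\<lambda>p. snd p j)" for S :: "((complex ^ 'n) \<times> (nat \<Rightarrow> complex)) set" and j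
    by (rule continuous_on_compose2[OF continuous_on_product_coordinates[of j] continuous_on_snd]) auto
  have "closed {p. (snd p j)\<^sup>2 = d j (fst p)}" for j
    by (intro closed_Collect_eq continuous_on_power coord
        continuous_on_compose2[OF complex_polynomial_continuous_on[OF polynomial_d]])
      (auto intro: continuous_intros)
  then have cl: "closed (\<Inter>j. {p. (snd p j)\<^sup>2 = d j (fst p)})" by blast
  have \<Omega>_eq: "\<Omega> = (K \<times> Pi\<^sub>E UNIV (\<lambda>j. cball (0::complex) (c j))) \<inter> (\<Inter>j. {p. (snd p j)\<^sup>2 = d j (fst p)})"
    using norm_root_le assms(2) unfolding \<Omega>_def by (auto simp: PiE_def Pi_def subset_iff)
  have "compact \<Omega>" unfolding \<Omega>_eq by (rule compact_Int_closed[OF cp cl])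
  moreover have "continuous_on \<Omega> (\<lambda>p. \<Sum>j. snd p j)"
  proof (rule uniform_limit_theorem)
    show "uniform_limit \<Omega> (\<lambda>n p. \<Sum>j<n. snd p j) (\<lambda>p. \<Sum>j. snd p j) sequentially"
      using norm_root_le assms(2) summable_c by (intro Weierstrass_m_test) (auto simp: \<Omega>_def)
    show "\<forall>\<^sub>F n in sequentially. continuous_on \<Omega> (\<lambda>p. \<Sum>j<n. snd p j)"
      by (intro always_eventually allI continuous_on_sum coord)
  qed auto
  ultimately have "compact ((\<lambda>p. append_coord (fst p) (\<Sum>j. snd p j)) ` \<Omega>)"
    by (intro compact_continuous_image continuous_on_append_coord) (auto intro: continuous_intros)
  also have "(\<lambda>p. append_coord (fst p) (\<Sum>j. snd p j)) ` \<Omega> = root_graph d K"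
    unfolding \<Omega>_def root_graph_def limit_root_sums_def by (force simp: image_iff)
  finally show ?thesis .
qed

text \<open>
  A polynomial on the limit graph is approximated, uniformly, by its values on the graphs of the partial
  sums, to which the maximum principle for partial sums applies.
\<close>

lemma root_graph_hull_subset:
  "root_graph d (polynomial_hull X) \<subseteq> polynomial_hull (root_graph d X)"
proof
  let ?H = "polynomial_hull X"
  fix v assume "v \<in> root_graph d ?H"
  then obtain z w where v: "v = append_coord z w" and z: "z \<in> ?H" and w: "w \<in> limit_root_sums d z"
    unfolding root_graph_def by blast
  have XH: "X \<subseteq> ?H" by (rule subset_polynomial_hull[OF compact_X])
  have "root_graph d X \<noteq> {}" using first_coords_root_graph[of d X] X_nonempty by blast
  moreover have "cmod (q v) \<le> M"
    if q: "complex_polynomial q" and M: "\<forall>x\<in>root_graph d X. cmod (q x) \<le> M" for q M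
  proof (rule field_le_epsilon)
    fix e :: real assume "0 < e"
    let ?g = "\<lambda>p. q (append_coord (fst p) (snd p))"
    let ?S = "?H \<times> cball (0::complex) (1 / 2)"
    have "uniformly_continuous_on ?S ?g"
      by (intro compact_uniformly_continuous compact_Times compact_polynomial_hull[OF compact_X] compact_cball
          continuous_on_compose2[OF complex_polynomial_continuous_on[OF q]] continuous_intros) auto
    then obtain \<delta> where "\<delta> > 0" and
      \<delta>: "\<And>p p'. p \<in> ?S \<Longrightarrow> p' \<in> ?S \<Longrightarrow> dist p' p < \<delta> \<Longrightarrow> dist (?g p') (?g p) < e / 2"
      unfolding uniformly_continuous_on_def using \<open>0 < e\<close> by (meson half_gt_zero)
    obtain n :: nat where "1 / \<delta> < real n" using reals_Archimedean2 by blast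
    then have "1 / (real n + 2) < \<delta>" using \<open>\<delta> > 0\<close> by (simp add: field_simps)
    then have n: "tail n < \<delta>" using tail_le_inverse[of n] by linarith
    have close: "cmod (q (append_coord x a) - q (append_coord x b)) < e / 2"
      if "x \<in> ?H" "cmod a \<le> 1 / 2" "cmod b \<le> 1 / 2" "cmod (a - b) \<le> tail n" for x a b
      using \<delta>[of "(x, b)" "(x, a)"] that n by (simp add: dist_Pair_Pair dist_norm)
    obtain t where t: "t \<in> root_sums d n z" "cmod (w - t) \<le> tail n"
      using limit_near_root_sums[OF z w] by blast
    have "cmod (q (append_coord z t)) \<le> M + e / 2"
    proof (rule root_sums_hull_bound[OF compact_X X_nonempty polynomial_d z q t(1)])
      fix x u assume x: "x \<in> X" and u: "u \<in> root_sums d n x"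
      have xH: "x \<in> ?H" using x XH by blast
      obtain u' where u': "u' \<in> limit_root_sums d x" "cmod (u' - u) \<le> tail n"
        using root_sums_near_limit[OF xH u] by blast
      have "cmod (q (append_coord x u')) \<le> M"
        using M x u'(1) by (simp add: mem_root_graph_iff)
      moreover have "cmod (q (append_coord x u') - q (append_coord x u)) < e / 2"
        using close[OF xH _ _ u'(2)] norm_limit_root_sums_le[OF xH u'(1)] norm_root_sums_le[OF xH u] by blast
      ultimately show "cmod (q (append_coord x u)) \<le> M + e / 2"
        using norm_triangle_sub[of "q (append_coord x u)" "q (append_coord x u')"]
        by (simp add: norm_minus_commute)
    qed
    moreover have "cmod (q v - q (append_coord z t)) < e / 2"
      unfolding v using close[OF z _ _ t(2)] norm_limit_root_sums_le[OF z w] norm_root_sums_le[OF z t(1)] by blast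
    ultimately show "cmod (q v) \<le> M + e"
      using norm_triangle_sub[of "q v" "q (append_coord z t)"] by simp
  qed
  ultimately show "v \<in> polynomial_hull (root_graph d X)"
    using mem_polynomial_hull_iff[OF compact_root_graph[OF compact_X XH]] by blast
qed

text \<open>
  On the graph over \<open>X\<close> the \<open>n\<close>-th eliminant is at most the \<open>n\<close>-th tail: all its factors are at most \<open>1\<close> and one
  factor is that small. The bound persists on the hull, so at a point \<open>(z, w)\<close> of the hull, \<open>w\<close> is within
  \<open>1 / (n + 2)\<close> of a partial sum over \<open>z\<close>, hence within \<open>2 / (n + 2)\<close> of the fibre of the limit graph.
\<close>

lemma hull_root_graph_subset:
  "polynomial_hull (root_graph d X) \<subseteq> root_graph d (polynomial_hull X)"
proof
  let ?H = "polynomial_hull X"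
  fix v assume v: "v \<in> polynomial_hull (root_graph d X)"
  define z w where "z = first_coords v" and "w = v $ None"
  have XH: "X \<subseteq> ?H" by (rule subset_polynomial_hull[OF compact_X])
  have ne: "root_graph d X \<noteq> {}" using first_coords_root_graph[of d X] X_nonempty by blast
  have bound: "cmod (q v) \<le> M" if "complex_polynomial q" "\<forall>x\<in>root_graph d X. cmod (q x) \<le> M" for q M
    using v that mem_polynomial_hull_iff[OF compact_root_graph[OF compact_X XH] ne] by blast
  have z: "z \<in> ?H"
    unfolding mem_polynomial_hull_iff[OF compact_X X_nonempty] z_def
  proof (intro allI impI)
    fix p M assume "complex_polynomial p" "\<forall>x\<in>X. cmod (p x) \<le> M"
    then show "cmod (p (first_coords v)) \<le> M"
      by (intro bound[of "\<lambda>v. p (first_coords v)"] complex_polynomial_first_coords) (auto simp: mem_root_graph_iff)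
  qed
  let ?F = "limit_root_sums d z"
  have "compact ((\<lambda>v. v $ None) ` root_graph d {z})"
    using z by (intro compact_continuous_image compact_root_graph) (auto intro: continuous_intros)
  also have "(\<lambda>v. v $ None) ` root_graph d {z} = ?F"
    unfolding root_graph_def by force
  finally have F: "closed ?F" by (rule compact_imp_closed)
  have "infdist w ?F \<le> 2 / (real n + 2)" for n
  proof -
    let ?\<delta> = "infdist w ?F - tail n"
    obtain Q where Q: "complex_polynomial Q"
      and lower: "\<And>z w \<delta>. 0 \<le> \<delta> \<Longrightarrow> (\<And>t. t \<in> root_sums d n z \<Longrightarrow> \<delta> \<le> cmod (w - t)) \<Longrightarrow>
       \<delta> ^ 2 ^ n \<le> cmod (Q (append_coord z w))"
      and upper: "\<And>z w t \<tau> K. t \<in> root_sums d n z \<Longrightarrow> cmod (w - t) \<le> \<tau> \<Longrightarrow>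
       (\<And>t. t \<in> root_sums d n z \<Longrightarrow> cmod (w - t) \<le> K) \<Longrightarrow>
       cmod (Q (append_coord z w)) \<le> \<tau> * K ^ (2 ^ n - 1)"
      using root_sums_eliminant[of d n, OF polynomial_d] by metis
    have "cmod (Q x) \<le> tail n" if x_mem: "x \<in> root_graph d X" for x
    proof -
      obtain y u where x: "x = append_coord y u" and y: "y \<in> ?H" and u: "u \<in> limit_root_sums d y"
        using x_mem XH unfolding root_graph_def by blast
      obtain t where t: "t \<in> root_sums d n y" "cmod (u - t) \<le> tail n"
        using limit_near_root_sums[OF y u] by blast
      have "cmod (u - t) \<le> 1" if "t \<in> root_sums d n y" for t
        using norm_triangle_ineq4[of u t] norm_limit_root_sums_le[OF y u] norm_root_sums_le[OF y that] by linarith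
      then show ?thesis using upper[OF t, of 1] x by simp
    qed
    then have Qv: "cmod (Q (append_coord z w)) \<le> tail n"
      using bound[OF Q] by (simp add: z_def w_def)
    have "?\<delta> \<le> 1 / (real n + 2)"
    proof (cases "0 \<le> ?\<delta>")
      case True
      have "?\<delta> \<le> cmod (w - t)" if t: "t \<in> root_sums d n z" for t
      proof -
        obtain u where u: "u \<in> ?F" "cmod (u - t) \<le> tail n"
          using root_sums_near_limit[OF z t] by blast
        have "infdist w ?F \<le> cmod (w - u)" using infdist_le[OF u(1), of w] by (simp add: dist_norm)
        also have "\<dots> \<le> cmod (w - t) + cmod (u - t)"
          using norm_triangle_ineq4[of "w - t" "u - t"] by simp
        finally show ?thesis using u(2) by simp
      qed
      then have "?\<delta> ^ 2 ^ n \<le> cmod (Q (append_coord z w))" by (rule lower[OF True])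
      then have "?\<delta> ^ 2 ^ n \<le> (1 / (real n + 2)) ^ 2 ^ n"
        using Qv tail_le[of n] by linarith
      then have "?\<delta> ^ Suc (2 ^ n - 1) \<le> (1 / (real n + 2)) ^ Suc (2 ^ n - 1)"
        by simp
      then show ?thesis by (rule power_le_imp_le_base) simp
    next
      case False
      moreover have "0 \<le> 1 / (real n + 2)" by simp
      ultimately show ?thesis by linarith
    qed
    then show ?thesis using tail_le_inverse[of n] by simp
  qed
  then have "infdist w ?F \<le> 0" by (rule nonpos_if_le_inverse_nat)
  then have "infdist w ?F = 0" using infdist_nonneg[of w ?F] by linarith
  then have "w \<in> ?F"
    using in_closed_iff_infdist_zero[OF F limit_root_sums_nonempty] by blast
  then show "v \<in> root_graph d ?H"
    using z by (simp add: mem_root_graph_iff z_def w_def)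
qed

lemma hull_root_graph:
  "polynomial_hull (root_graph d X) = root_graph d (polynomial_hull X)"
  using root_graph_hull_subset hull_root_graph_subset by blast

text \<open>
  The fibre lies in \<open>2 ^ n\<close> discs with the \<open>n\<close>-th tail as radius, whose total diameter tends to zero. A
  connected subset containing two points would map onto an interval of positive length under the
  distance from one of them.
\<close>

lemma totally_disconnected_fibre:
  assumes z: "z \<in> polynomial_hull X"
  shows "totally_disconnected {v \<in> root_graph d (polynomial_hull X). first_coords v = z}"
  unfolding totally_disconnected_def
proof (intro allI impI ballI)
  fix T x y
  assume T: "T \<subseteq> {v \<in> root_graph d (polynomial_hull X). first_coords v = z}" "connected T"
    and xy: "x \<in> T" "y \<in> T"
  let ?h = "\<lambda>v :: complex ^ 'n option. cmod (v $ None - x $ None)"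
  have "connected (?h ` T)"
    by (intro connected_continuous_image T continuous_intros)
  then have I: "{0..?h y} \<subseteq> ?h ` T"
    using xy by (intro connected_contains_Icc) (auto intro!: rev_image_eqI[of x])
  have "?h y \<le> 2 / (real n + 2)" for n
  proof -
    have "{0..?h y} \<subseteq> (\<Union>t\<in>root_sums d n z. {cmod (t - x $ None) - tail n..cmod (t - x $ None) + tail n})"
    proof
      fix r assume "r \<in> {0..?h y}"
      then obtain v where v: "v \<in> T" "r = ?h v" using I by blast
      then have "v $ None \<in> limit_root_sums d z" using T(1) by (auto simp: mem_root_graph_iff)
      then obtain t where t: "t \<in> root_sums d n z" "cmod (v $ None - t) \<le> tail n"
        using limit_near_root_sums[OF z] by blast
      have "\<bar>r - cmod (t - x $ None)\<bar> \<le> tail n"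
        unfolding v(2) using norm_triangle_ineq3[of "v $ None - x $ None" "t - x $ None"] t(2) by simp
      then show "r \<in> (\<Union>t\<in>root_sums d n z. {cmod (t - x $ None) - tail n..cmod (t - x $ None) + tail n})"
        using t(1) by (auto simp: abs_le_iff intro!: bexI[of _ t])
    qed
    then have "?h y \<le> real (card (root_sums d n z)) * (2 * tail n)"
      by (rule interval_cover_length[OF finite_root_sums _ tail_nonneg])
    also have "\<dots> \<le> 2 ^ n * (2 * (1 / (real n + 2)) ^ 2 ^ n)"
      using tail_le[of n] tail_nonneg[of n] card_root_sums_le[of d n z]
      by (intro mult_mono) (auto simp: numeral_power_le_of_nat_cancel_iff of_nat_le_numeral_power_cancel_iff)
    also have "\<dots> \<le> 2 ^ n * (2 * (1 / (real n + 2)) ^ Suc n)"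
      using less_exp[of n] by (intro mult_left_mono power_decreasing) (auto simp: Suc_le_eq)
    also have "\<dots> = (2 / (real n + 2)) ^ Suc n"
      by (simp add: power_divide)
    also have "\<dots> \<le> (2 / (real n + 2)) ^ 1"
      by (intro power_decreasing) auto
    finally show ?thesis by simp
  qed
  then have "?h y \<le> 0" by (rule nonpos_if_le_inverse_nat)
  then have "y $ None = x $ None" by simp
  moreover have "first_coords x = first_coords y" using T(1) xy by auto
  ultimately show "x = y" by (metis append_coord_first_coords)
qed

end

section \<open>Square roots of holomorphic functions at a simple zero\<close>

text \<open>
  The holomorphic functions on a connected open set form an integral domain.
\<close>

lemma holomorphic_prod_eq_0:
  assumes S: "open S" "connected S" "S \<noteq> {}" and I: "finite I"
    and hol: "\<And>i. i \<in> I \<Longrightarrow> f i holomorphic_on S"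
    and zero: "\<And>z. z \<in> S \<Longrightarrow> (\<Prod>i\<in>I. f i z) = 0"
  obtains i where "i \<in> I" "\<And>z. z \<in> S \<Longrightarrow> f i z = 0"
proof -
  have "\<exists>i\<in>I. \<forall>z\<in>S. f i z = 0"
    using I hol zero
  proof (induction I rule: finite_induct)
    case empty
    then show ?case using S(3) by auto
  next
    case (insert i I)
    show ?case
    proof (cases "\<forall>z\<in>S. f i z = 0")
      case True
      then show ?thesis by blast
    next
      case False
      define T where "T = {z \<in> S. f i z \<noteq> 0}"
      have "continuous_on S (f i)" using insert.prems(1) holomorphic_on_imp_continuous_on by blast
      then have "open (f i -` (- {0}) \<inter> S)"
        using S(1) by (auto simp: continuous_on_open_vimage)
      moreover have "f i -` (- {0}) \<inter> S = T" unfolding T_def by auto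
      ultimately have T: "open T" "T \<noteq> {}" "T \<subseteq> S" using False unfolding T_def by auto
      have prod: "(\<lambda>z. \<Prod>i\<in>I. f i z) holomorphic_on S"
        using insert.prems(1) by (intro holomorphic_on_prod) auto
      have "(\<Prod>i\<in>I. f i z) = 0" if "z \<in> S" for z
      proof (rule analytic_continuation_open[OF T(1) S(1) T(2) S(2) T(3) prod _ _ that])
        show "(\<Prod>i\<in>I. f i z) = 0" if "z \<in> T" for z
          using insert.prems(2)[of z] insert.hyps that unfolding T_def by simp
      qed (rule holomorphic_on_const)
      then show ?thesis using insert.IH insert.prems(1) by auto
    qed
  qed
  then show ?thesis using that by blast
qed

text \<open>
  Because the exponents are distinct, no other term can cancel the term of lowest order.
\<close>

lemma leading_coefficient_vanishes:
  fixes V :: "nat \<Rightarrow> complex \<Rightarrow> complex" and e :: "nat \<Rightarrow> nat"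
  assumes J: "finite J" "J \<noteq> {}" and e: "strict_mono e" and \<rho>: "0 < \<rho>"
    and cont: "\<And>j. j \<in> J \<Longrightarrow> isCont (V j) 0"
    and zero: "\<And>t. t \<in> ball 0 \<rho> \<Longrightarrow> (\<Sum>j\<in>J. t ^ e j * V j t) = 0"
  obtains j where "j \<in> J" "V j 0 = 0"
proof -
  define m where "m = Min J"
  have m: "m \<in> J" "\<And>j. j \<in> J \<Longrightarrow> m \<le> j" using J by (auto simp: m_def)
  define S where "S = (\<lambda>t. \<Sum>j\<in>J. t ^ (e j - e m) * V j t)"
  have e_le: "e m \<le> e j" if "j \<in> J" for j
    using m(2)[OF that] e by (simp add: strict_mono_less_eq)
  have "S t = 0" if "t \<in> ball 0 \<rho> - {0}" for t
  proof -
    have "t ^ e m * S t = (\<Sum>j\<in>J. t ^ e j * V j t)"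
      unfolding S_def sum_distrib_left
      by (intro sum.cong refl) (simp add: e_le mult.assoc[symmetric] power_add[symmetric])
    then show ?thesis using zero[of t] that by simp
  qed
  then have "eventually (\<lambda>t. S t = 0) (at 0)"
    using \<rho> unfolding eventually_at by (intro exI[of _ \<rho>]) (auto simp: dist_commute)
  then have "(S \<longlongrightarrow> 0) (at 0)" by (rule tendsto_eventually)
  moreover have "(S \<longlongrightarrow> S 0) (at 0)"
    unfolding S_def using cont by (intro tendsto_intros) (auto simp: isCont_def)
  ultimately have "S 0 = 0" by (metis tendsto_unique trivial_limit_at)
  moreover have "S 0 = V m 0"
  proof -
    have "S 0 = (\<Sum>j\<in>J. if j = m then V m 0 else 0)"
      unfolding S_def
    proof (rule sum.cong)
      fix j assume "j \<in> J"
      then show "0 ^ (e j - e m) * V j 0 = (if j = m then V m 0 else 0)"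
        using m(2)[of j] e by (auto simp: power_0_left strict_mono_less_eq)
    qed simp
    then show ?thesis using m J by simp
  qed
  ultimately show ?thesis using that m by metis
qed

lemma square_mem_ball:
  assumes "t \<in> ball (0::complex) \<rho>" "\<rho> \<le> 1"
  shows "t\<^sup>2 \<in> ball 0 \<rho>"
proof -
  have "cmod t * cmod t \<le> cmod t * 1" using assms by (intro mult_left_mono) auto
  moreover have "cmod (t\<^sup>2) = cmod t * cmod t" by (simp add: power2_eq_square norm_mult)
  ultimately show ?thesis using assms by simp
qed

lemma holomorphic_sqrt_near_0:
  fixes G :: "complex \<Rightarrow> complex"
  assumes "G holomorphic_on ball 0 r" "0 < r" "G 0 \<noteq> 0"
  obtains h \<rho> where "0 < \<rho>" "\<rho> \<le> r" "\<rho> \<le> 1" "h holomorphic_on ball 0 \<rho>"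
    "\<And>\<zeta>. \<zeta> \<in> ball 0 \<rho> \<Longrightarrow> (h \<zeta>)\<^sup>2 = G \<zeta>"
proof -
  have "continuous (at 0) G"
    using assms by (metis centre_in_ball continuous_on_eq_continuous_at holomorphic_on_imp_continuous_on open_ball)
  then obtain \<delta> where \<delta>: "\<delta> > 0" "\<And>\<zeta>. dist 0 \<zeta> < \<delta> \<Longrightarrow> G \<zeta> \<noteq> 0"
    using continuous_at_avoid[of 0 G 0] assms(3) by blast
  define \<rho> where "\<rho> = min \<delta> (min r 1)"
  have \<rho>: "0 < \<rho>" "\<rho> \<le> r" "\<rho> \<le> 1" using \<delta> assms by (auto simp: \<rho>_def)
  have hol: "G holomorphic_on ball 0 \<rho>" using assms(1) \<rho> by (meson holomorphic_on_subset subset_ball)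
  have nz: "G \<zeta> \<noteq> 0" if "\<zeta> \<in> ball 0 \<rho>" for \<zeta> using that \<delta>(2)[of \<zeta>] by (simp add: \<rho>_def)
  obtain h where h: "h holomorphic_on ball 0 \<rho>" "\<And>\<zeta>. \<zeta> \<in> ball 0 \<rho> \<Longrightarrow> G \<zeta> = (h \<zeta>)\<^sup>2"
    using contractible_imp_holomorphic_sqrt[OF hol convex_imp_contractible[OF convex_ball] nz] by blast
  show ?thesis by (rule that[OF \<rho> h(1)]) (simp add: h(2))
qed

text \<open>
  After the substitution \<open>\<zeta> = t\<^sup>2\<close> the square root of \<open>\<kappa> g ^ m\<close> becomes a holomorphic function of \<open>t\<close>, and its
  parity tells whether the original root branches at \<open>0\<close>: it is odd, of exact order \<open>m\<close>, when \<open>g\<close> has a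
  simple zero, and even when \<open>g 0 \<noteq> 0\<close> or \<open>g\<close> vanishes identically.
\<close>

lemma sqrt_after_squaring:
  fixes g :: "complex \<Rightarrow> complex"
  assumes g: "g holomorphic_on ball 0 r" "0 < r" and m: "odd m" and \<kappa>: "\<kappa> \<noteq> 0"
    and alt: "(\<forall>\<zeta>\<in>ball 0 r. g \<zeta> = g 0) \<or> deriv g 0 \<noteq> 0"
  shows "\<exists>\<rho> H V. 0 < \<rho> \<and> \<rho> \<le> r \<and> \<rho> \<le> 1 \<and> H holomorphic_on ball 0 \<rho> \<and>
    (\<forall>t\<in>ball 0 \<rho>. (H t)\<^sup>2 = \<kappa> * g (t\<^sup>2) ^ m) \<and>
    (if g 0 = 0 \<and> deriv g 0 \<noteq> 0
     then isCont V 0 \<and> V 0 \<noteq> 0 \<and> (\<forall>t\<in>ball 0 \<rho>. H t = t ^ m * V t \<and> H (- t) = - H t)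
     else (\<forall>t\<in>ball 0 \<rho>. H (- t) = H t))"
proof -
  consider (zero) "g 0 = 0" "deriv g 0 \<noteq> 0" | (nonzero) "g 0 \<noteq> 0" | (const) "g 0 = 0" "deriv g 0 = 0" by blast
  then show ?thesis
  proof cases
    case zero
    define u where "u = (\<lambda>\<zeta>. if \<zeta> = 0 then deriv g 0 else (g \<zeta> - g 0) / (\<zeta> - 0))"
    have u: "u holomorphic_on ball 0 r" unfolding u_def by (rule pole_lemma_open[OF g(1) open_ball])
    have gu: "g \<zeta> = \<zeta> * u \<zeta>" for \<zeta> using zero by (simp add: u_def)
    have hol: "(\<lambda>\<zeta>. \<kappa> * u \<zeta> ^ m) holomorphic_on ball 0 r" using u by (intro holomorphic_intros)
    have ne: "\<kappa> * u 0 ^ m \<noteq> 0" using zero \<kappa> by (simp add: u_def)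
    obtain h \<rho> where \<rho>: "0 < \<rho>" "\<rho> \<le> r" "\<rho> \<le> 1" and h: "h holomorphic_on ball 0 \<rho>"
      "\<And>\<zeta>. \<zeta> \<in> ball 0 \<rho> \<Longrightarrow> (h \<zeta>)\<^sup>2 = \<kappa> * u \<zeta> ^ m"
      by (rule holomorphic_sqrt_near_0[OF hol g(2) ne]) (rule that)
    define V where "V = (\<lambda>t. h (t\<^sup>2))"
    have V: "V holomorphic_on ball 0 \<rho>"
      unfolding V_def using square_mem_ball \<rho>
      by (intro holomorphic_on_compose_gen[OF _ h(1), unfolded o_def]) (auto intro!: holomorphic_intros)
    have "isCont V 0"
      using V \<rho> by (metis centre_in_ball continuous_on_eq_continuous_at holomorphic_on_imp_continuous_on open_ball)
    moreover have "V 0 \<noteq> 0"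
      using h(2)[of 0] \<rho> ne by (auto simp: V_def)
    moreover have "(t ^ m * V t)\<^sup>2 = \<kappa> * g (t\<^sup>2) ^ m" if "t \<in> ball 0 \<rho>" for t
      using h(2)[OF square_mem_ball[OF that \<rho>(3)]] gu[of "t\<^sup>2"]
      by (simp add: V_def power_mult_distrib mult_ac flip: power_mult)
    moreover have "(\<lambda>t. t ^ m * V t) holomorphic_on ball 0 \<rho>" using V by (intro holomorphic_intros)
    moreover have "(- t) ^ m * V (- t) = - (t ^ m * V t)" for t
      using m by (simp add: V_def)
    ultimately show ?thesis
      using \<rho> zero by (intro exI[where x = \<rho>] exI[where x = "\<lambda>t. t ^ m * V t"] exI[where x = V]) simp
  next
    case nonzero
    have hol: "(\<lambda>\<zeta>. \<kappa> * g \<zeta> ^ m) holomorphic_on ball 0 r" using g by (intro holomorphic_intros)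
    have ne: "\<kappa> * g 0 ^ m \<noteq> 0" using nonzero \<kappa> by simp
    obtain h \<rho> where \<rho>: "0 < \<rho>" "\<rho> \<le> r" "\<rho> \<le> 1" and h: "h holomorphic_on ball 0 \<rho>"
      "\<And>\<zeta>. \<zeta> \<in> ball 0 \<rho> \<Longrightarrow> (h \<zeta>)\<^sup>2 = \<kappa> * g \<zeta> ^ m"
      by (rule holomorphic_sqrt_near_0[OF hol g(2) ne]) (rule that)
    have "(\<lambda>t. h (t\<^sup>2)) holomorphic_on ball 0 \<rho>"
      using square_mem_ball \<rho>
      by (intro holomorphic_on_compose_gen[OF _ h(1), unfolded o_def]) (auto intro!: holomorphic_intros)
    moreover have "(h (t\<^sup>2))\<^sup>2 = \<kappa> * g (t\<^sup>2) ^ m" if "t \<in> ball 0 \<rho>" for t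
      by (rule h(2)[OF square_mem_ball[OF that \<rho>(3)]])
    ultimately show ?thesis
      using \<rho> nonzero by (intro exI[where x = \<rho>] exI[where x = "\<lambda>t. h (t\<^sup>2)"]) simp
  next
    case const
    define \<rho> where "\<rho> = min r 1"
    have \<rho>: "0 < \<rho>" "\<rho> \<le> r" "\<rho> \<le> 1" using g(2) by (auto simp: \<rho>_def)
    have "0\<^sup>2 = \<kappa> * g (t\<^sup>2) ^ m" if "t \<in> ball 0 \<rho>" for t
    proof -
      have "t\<^sup>2 \<in> ball 0 r" using square_mem_ball[OF that \<rho>(3)] \<rho>(2) by simp
      then have "g (t\<^sup>2) = g 0" using alt const(2) by blast
      then show ?thesis using const(1) m by (auto simp: power_0_left elim: oddE)
    qed
    then show ?thesis
      using \<rho> const by (intro exI[where x = \<rho>] exI[where x = "\<lambda>t. 0"]) (simp add: holomorphic_on_const)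
  qed
qed

text \<open>
  After the substitution \<open>\<zeta> = t\<^sup>2\<close> the function \<open>w (t\<^sup>2)\<close> is one of finitely many signed sums of the roots at every
  point, hence one fixed signed sum everywhere by the integral domain property. It is even in \<open>t\<close>, so
  its odd terms add up to zero. They come from the \<open>j\<close> for which the \<open>j\<close>-th linear factor has a simple zero
  at \<open>0\<close> along \<open>f\<close>, and their orders \<open>2 j + 1\<close> are distinct, so there can be no such \<open>j\<close>; but \<open>k\<close> is one.

  The hypothesis on the coordinates excludes multiple zeros of the linear factors, which would produce odd terms of
  order \<open>(2 j + 1) e\<close> for a zero of odd multiplicity \<open>e\<close>, and these orders may coincide.
\<close>

lemma no_holomorphic_root_sum_near_simple_zero:
  fixes f :: "complex \<Rightarrow> complex ^ 'n" and idx :: "nat \<Rightarrow> 'n" and a \<kappa> :: "nat \<Rightarrow> complex"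
  assumes r: "0 < r" and f: "\<And>l. (\<lambda>\<zeta>. f \<zeta> $ l) holomorphic_on ball 0 r"
    and w: "w holomorphic_on ball 0 r"
    and \<kappa>: "\<And>j. \<kappa> j \<noteq> 0"
    and alt: "\<And>l. (\<forall>\<zeta>\<in>ball 0 r. f \<zeta> $ l = f 0 $ l) \<or> deriv (\<lambda>\<zeta>. f \<zeta> $ l) 0 \<noteq> 0"
    and k: "k < n" "f 0 $ idx k = a k" "deriv (\<lambda>\<zeta>. f \<zeta> $ idx k) 0 \<noteq> 0"
  shows "\<exists>\<zeta>\<in>ball 0 r. w \<zeta> \<notin> root_sums (\<lambda>j z. \<kappa> j * (z $ idx j - a j) ^ (2 * j + 1)) n (f \<zeta>)"
proof (rule ccontr)
  let ?d = "\<lambda>j z. \<kappa> j * (z $ idx j - a j) ^ (2 * j + 1)"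
  assume "\<not> ?thesis"
  then have w_mem: "w \<zeta> \<in> root_sums ?d n (f \<zeta>)" if "\<zeta> \<in> ball 0 r" for \<zeta> using that by blast
  define g where "g = (\<lambda>j \<zeta>. f \<zeta> $ idx j - a j)"
  have g: "g j holomorphic_on ball 0 r" for j
    unfolding g_def by (intro holomorphic_intros f)
  have "(\<lambda>\<zeta>. f \<zeta> $ l) field_differentiable at 0" for l
    using f[of l] r by (meson centre_in_ball holomorphic_on_imp_differentiable_at open_ball)
  then have dg: "deriv (g j) 0 = deriv (\<lambda>\<zeta>. f \<zeta> $ idx j) 0" for j
    unfolding g_def by simp
  have altg: "(\<forall>\<zeta>\<in>ball 0 r. g j \<zeta> = g j 0) \<or> deriv (g j) 0 \<noteq> 0" for j
    using alt[of "idx j"] unfolding dg by (auto simp: g_def)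
  \<comment> \<open>the terms that branch at \<open>0\<close>\<close>
  define J where "J = {j \<in> {..<n}. g j 0 = 0 \<and> deriv (g j) 0 \<noteq> 0}"
  have "\<forall>j. \<exists>\<rho> H V. 0 < \<rho> \<and> \<rho> \<le> r \<and> \<rho> \<le> 1 \<and> H holomorphic_on ball 0 \<rho> \<and>
    (\<forall>t\<in>ball 0 \<rho>. (H t)\<^sup>2 = \<kappa> j * g j (t\<^sup>2) ^ (2 * j + 1)) \<and>
    (if g j 0 = 0 \<and> deriv (g j) 0 \<noteq> 0
     then isCont V 0 \<and> V 0 \<noteq> 0 \<and> (\<forall>t\<in>ball 0 \<rho>. H t = t ^ (2 * j + 1) * V t \<and> H (- t) = - H t)
     else (\<forall>t\<in>ball 0 \<rho>. H (- t) = H t))"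
    by (intro allI sqrt_after_squaring[OF g r _ \<kappa> altg]) simp
  then obtain \<rho>s H V where *: "\<forall>j. 0 < \<rho>s j \<and> \<rho>s j \<le> r \<and> \<rho>s j \<le> (1::real) \<and> H j holomorphic_on ball 0 (\<rho>s j) \<and>
    (\<forall>t\<in>ball 0 (\<rho>s j). (H j t)\<^sup>2 = \<kappa> j * g j (t\<^sup>2) ^ (2 * j + 1)) \<and>
    (if g j 0 = 0 \<and> deriv (g j) 0 \<noteq> 0
     then isCont (V j) 0 \<and> V j 0 \<noteq> 0 \<and> (\<forall>t\<in>ball 0 (\<rho>s j). H j t = t ^ (2 * j + 1) * V j t \<and> H j (- t) = - H j t)
     else (\<forall>t\<in>ball 0 (\<rho>s j). H j (- t) = H j t))"
    by (auto simp only: choice_iff)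
  define \<rho> where "\<rho> = Min (\<rho>s ` {..<n})"
  have fin: "finite (\<rho>s ` {..<n})" "\<rho>s ` {..<n} \<noteq> {}" using k(1) by auto
  have \<rho>_le: "\<rho> \<le> \<rho>s j" if "j < n" for j unfolding \<rho>_def using that by (intro Min_le) auto
  have \<rho>: "0 < \<rho>" "\<rho> \<le> r" "\<rho> \<le> 1"
    using * \<rho>_le[OF k(1)] fin by (auto simp: \<rho>_def intro: order_trans)
  have in_ball: "t \<in> ball 0 (\<rho>s j)" if "j < n" "t \<in> ball 0 \<rho>" for j t
    using \<rho>_le[OF that(1)] that(2) by simp
  have H: "H j holomorphic_on ball 0 \<rho>" if "j < n" for j
  proof (rule holomorphic_on_subset)
    show "H j holomorphic_on ball 0 (\<rho>s j)" using * by blast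
    show "ball 0 \<rho> \<subseteq> ball 0 (\<rho>s j)" using \<rho>_le[OF that] by (rule subset_ball)
  qed
  have H_sq: "(H j t)\<^sup>2 = ?d j (f (t\<^sup>2))" if "j < n" "t \<in> ball 0 \<rho>" for j t
    using spec[OF *, of j] in_ball[OF that] unfolding g_def by blast
  have H_odd: "isCont (V j) 0 \<and> V j 0 \<noteq> 0 \<and> (\<forall>t\<in>ball 0 \<rho>. H j t = t ^ (2 * j + 1) * V j t \<and> H j (- t) = - H j t)"
    if "j \<in> J" for j
  proof -
    have j: "j < n" "g j 0 = 0 \<and> deriv (g j) 0 \<noteq> 0" using that by (auto simp: J_def)
    show ?thesis using spec[OF *, of j, unfolded if_P[OF j(2)]] in_ball[OF j(1)] by blast
  qed
  have H_even: "H j (- t) = H j t" if "j < n" "j \<notin> J" "t \<in> ball 0 \<rho>" for j t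
  proof -
    have j: "\<not> (g j 0 = 0 \<and> deriv (g j) 0 \<noteq> 0)" using that by (auto simp: J_def)
    show ?thesis using spec[OF *, of j, unfolded if_not_P[OF j]] in_ball[OF that(1,3)] by blast
  qed
  define W where "W = (\<lambda>t. w (t\<^sup>2))"
  have W: "W holomorphic_on ball 0 \<rho>"
    unfolding W_def
  proof (rule holomorphic_on_compose_gen[OF _ w, unfolded o_def])
    show "(\<lambda>t::complex. t\<^sup>2) ` ball 0 \<rho> \<subseteq> ball 0 r"
      using square_mem_ball[OF _ \<rho>(3)] subset_ball[OF \<rho>(2), of "0::complex"] by blast
  qed (intro holomorphic_intros)
  \<comment> \<open>the sign choices; \<open>W\<close> minus one of the signed sums vanishes at each point, so the product vanishes identically\<close>
  let ?E = "{..<n} \<rightarrow>\<^sub>E {1, - 1 :: complex}"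
  have "(\<Prod>\<epsilon>\<in>?E. W t - (\<Sum>j<n. \<epsilon> j * H j t)) = 0" if t: "t \<in> ball 0 \<rho>" for t
  proof -
    have t2: "t\<^sup>2 \<in> ball 0 r" using square_mem_ball[OF t \<rho>(3)] \<rho>(2) by simp
    obtain s where s: "\<And>j. (s j)\<^sup>2 = ?d j (f (t\<^sup>2))" "w (t\<^sup>2) = (\<Sum>j<n. s j)"
      by (rule root_sumsE[OF w_mem[OF t2]]) (rule that)
    define \<epsilon> where "\<epsilon> = restrict (\<lambda>j. if s j = H j t then 1 else - 1 :: complex) {..<n}"
    have "s j = \<epsilon> j * H j t" if j: "j < n" for j
    proof -
      have "(s j)\<^sup>2 = (H j t)\<^sup>2" unfolding s(1) H_sq[OF j t] ..
      then show ?thesis using j by (auto simp: \<epsilon>_def power2_eq_iff)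
    qed
    then have "W t - (\<Sum>j<n. \<epsilon> j * H j t) = 0" unfolding W_def s(2) by simp
    moreover have "\<epsilon> \<in> ?E" unfolding \<epsilon>_def by auto
    moreover have "finite ?E" by (intro finite_PiE) auto
    ultimately show ?thesis by (meson prod_zero)
  qed
  then obtain \<epsilon> where \<epsilon>: "\<epsilon> \<in> ?E" "\<And>t. t \<in> ball 0 \<rho> \<Longrightarrow> W t - (\<Sum>j<n. \<epsilon> j * H j t) = 0"
    using \<rho>(1) W H
    by (elim holomorphic_prod_eq_0[rotated 5])
      (auto intro!: holomorphic_intros finite_PiE)
  have "(\<Sum>j\<in>J. t ^ (2 * j + 1) * (\<epsilon> j * V j t)) = 0" if t: "t \<in> ball 0 \<rho>" for t
  proof -
    have t': "- t \<in> ball 0 \<rho>" using t by simp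
    have "(\<Sum>j<n. \<epsilon> j * H j t) = W t" "(\<Sum>j<n. \<epsilon> j * H j (- t)) = W (- t)"
      using \<epsilon>(2)[OF t] \<epsilon>(2)[OF t'] by simp_all
    moreover have "W (- t) = W t" by (simp add: W_def)
    ultimately have "0 = (\<Sum>j<n. \<epsilon> j * H j t - \<epsilon> j * H j (- t))"
      by (simp add: sum_subtractf)
    also have "\<dots> = (\<Sum>j<n. if j \<in> J then 2 * (t ^ (2 * j + 1) * (\<epsilon> j * V j t)) else 0)"
    proof (rule sum.cong)
      fix j assume j: "j \<in> {..<n}"
      show "\<epsilon> j * H j t - \<epsilon> j * H j (- t) = (if j \<in> J then 2 * (t ^ (2 * j + 1) * (\<epsilon> j * V j t)) else 0)"
      proof (cases "j \<in> J")
        case True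
        then have "H j (- t) = - H j t" "H j t = t ^ (2 * j + 1) * V j t" using H_odd t by blast+
        with True show ?thesis by (simp only: if_True) (simp add: mult_ac)
      next
        case False
        then show ?thesis using H_even[of j t] j t by simp
      qed
    qed simp
    also have "\<dots> = (\<Sum>j\<in>J. 2 * (t ^ (2 * j + 1) * (\<epsilon> j * V j t)))"
      by (subst sum.inter_restrict[symmetric]) (auto simp: J_def intro!: sum.cong)
    finally show ?thesis by (simp flip: sum_distrib_left)
  qed
  moreover have "finite J" unfolding J_def by simp
  moreover have "k \<in> J" unfolding J_def using k by (simp add: dg) (simp add: g_def)
  moreover have "strict_mono (\<lambda>j::nat. 2 * j + 1)" by (intro strict_monoI) simp
  moreover have "isCont (\<lambda>t. \<epsilon> j * V j t) 0" if "j \<in> J" for j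
    using H_odd[OF that] by (intro continuous_intros) auto
  ultimately obtain j where j: "j \<in> J" "\<epsilon> j * V j 0 = 0"
    using leading_coefficient_vanishes[of J "\<lambda>j. 2 * j + 1" \<rho> "\<lambda>j t. \<epsilon> j * V j t"] \<rho>(1) by blast
  moreover have "\<epsilon> j \<in> {1, - 1}" using \<epsilon>(1) j(1) unfolding J_def by blast
  ultimately show False using H_odd[OF j(1)] by auto
qed

section \<open>Discs near the graph of the partial sums\<close>

lemma Montel_vec:
  fixes \<Phi> :: "nat \<Rightarrow> complex \<Rightarrow> complex ^ 'm"
  assumes S: "open S"
    and hol: "\<And>n l. (\<lambda>z. \<Phi> n z $ l) holomorphic_on S"
    and bound: "\<And>n z l. z \<in> S \<Longrightarrow> cmod (\<Phi> n z $ l) \<le> B"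
  obtains g r where "strict_mono (r :: nat \<Rightarrow> nat)" "\<And>l. (\<lambda>z. g z $ l) holomorphic_on S"
    "\<And>l K. compact K \<Longrightarrow> K \<subseteq> S \<Longrightarrow>
       uniform_limit K (\<lambda>n z. \<Phi> (r n) z $ l) (\<lambda>z. g z $ l) sequentially"
proof -
  have "\<exists>r h. strict_mono (r :: nat \<Rightarrow> nat) \<and> (\<forall>l\<in>I. h l holomorphic_on S \<and>
      (\<forall>K. compact K \<longrightarrow> K \<subseteq> S \<longrightarrow> uniform_limit K (\<lambda>n z. \<Phi> (r n) z $ l) (h l) sequentially))"
    if "finite I" for I
    using that
  proof (induction I rule: finite_induct)
    case empty
    show ?case using strict_mono_id by auto
  next
    case (insert l I)
    then obtain r h where r: "strict_mono (r :: nat \<Rightarrow> nat)"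
      and h: "\<forall>l\<in>I. h l holomorphic_on S \<and>
        (\<forall>K. compact K \<longrightarrow> K \<subseteq> S \<longrightarrow> uniform_limit K (\<lambda>n z. \<Phi> (r n) z $ l) (h l) sequentially)"
      by blast
    define \<F> where "\<F> = (\<lambda>n z. \<Phi> (r n) z $ l)"
    define \<H> where "\<H> = {f. f holomorphic_on S \<and> (\<forall>z\<in>S. cmod (f z) \<le> B)}"
    have 1: "f holomorphic_on S" if "f \<in> \<H>" for f
      using that by (simp add: \<H>_def)
    have 2: "\<exists>B. \<forall>f\<in>\<H>. \<forall>z\<in>K. cmod (f z) \<le> B" if "compact K" "K \<subseteq> S" for K
      using that(2) by (intro exI[of _ B]) (auto simp: \<H>_def)
    have 3: "range \<F> \<subseteq> \<H>"
      using hol bound by (auto simp: \<F>_def \<H>_def)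
    obtain g q where g: "g holomorphic_on S" and q: "strict_mono (q :: nat \<Rightarrow> nat)"
      and lim': "\<And>K. compact K \<Longrightarrow> K \<subseteq> S \<Longrightarrow> uniform_limit K (\<F> \<circ> q) g sequentially"
      by (rule Montel[OF S 1 2 3]) (assumption+, rule that)
    have "uniform_limit K (\<lambda>n z. \<Phi> ((r \<circ> q) n) z $ j) ((h(l := g)) j) sequentially"
      if "j \<in> insert l I" "compact K" "K \<subseteq> S" for j K
    proof (cases "j = l")
      case True
      then show ?thesis using lim'[OF that(2,3)] by (simp add: \<F>_def o_def)
    next
      case False
      then show ?thesis
        using filterlim_compose[OF _ filterlim_subseq[OF q], of "\<lambda>n z. \<Phi> (r n) z $ j"] h that by (simp add: o_def)
    qed
    moreover have "(h(l := g)) j holomorphic_on S" if "j \<in> insert l I" for j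
      using that g h by auto
    ultimately show ?case
      using strict_mono_o[OF r q] by (intro exI[where x = "r \<circ> q"] exI[where x = "h(l := g)"]) blast
  qed
  from this[OF finite, of UNIV] obtain r h where "strict_mono (r :: nat \<Rightarrow> nat)"
    "\<forall>l\<in>UNIV. h l holomorphic_on S \<and>
      (\<forall>K. compact K \<longrightarrow> K \<subseteq> S \<longrightarrow> uniform_limit K (\<lambda>n z. \<Phi> (r n) z $ l) (h l) sequentially)"
    by blast
  then show ?thesis
    by (intro that[of r "\<lambda>z. \<chi> l. h l z"]) simp_all
qed

lemma root_sums_bounded:
  assumes "compact K" and d: "\<And>j. complex_polynomial (d j)"
  shows "\<exists>B. \<forall>z\<in>K. \<forall>t\<in>root_sums d n z. cmod t \<le> B"
proof (induction n)
  case 0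
  show ?case by auto
next
  case (Suc n)
  then obtain B where B: "\<And>z t. z \<in> K \<Longrightarrow> t \<in> root_sums d n z \<Longrightarrow> cmod t \<le> B" by blast
  have "bounded (d n ` K)"
    using assms by (intro compact_imp_bounded compact_continuous_image complex_polynomial_continuous_on)
  then obtain C where C: "\<And>z. z \<in> K \<Longrightarrow> cmod (d n z) \<le> C" by (auto simp: bounded_iff)
  have "cmod t \<le> B + (1 + C)" if z: "z \<in> K" and t: "t \<in> root_sums d (Suc n) z" for z t
  proof -
    obtain u s where u: "t = u + s" "u \<in> root_sums d n z" "s\<^sup>2 = d n z" using t by auto
    have "(cmod s)\<^sup>2 \<le> C" using C[OF z] u(3) by (metis norm_power)
    moreover have "0 \<le> (cmod s - 1 / 2)\<^sup>2" by simp
    then have "cmod s \<le> (cmod s)\<^sup>2 + 1" by (simp add: power2_eq_square algebra_simps)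
    ultimately have "cmod s \<le> 1 + C" by linarith
    then show ?thesis
      unfolding u(1) using B[OF z u(2)] norm_triangle_ineq[of u s] by linarith
  qed
  then show ?case by blast
qed

text \<open>
  Discs over \<open>K\<close> whose \<open>i\<close>-th coordinate takes the value \<open>b\<close> at the centre with a quantitative bound on
  transversality. The alternative for the coordinates is stated so that it survives locally
  uniform limits: a limit of coordinates with derivative at least \<open>\<eta>\<close> has this property, and a limit of
  constants is constant.
\<close>

definition transversal_disc ::
  "(complex ^ ('n::finite)) set \<Rightarrow> 'n \<Rightarrow> complex \<Rightarrow> real \<Rightarrow> (complex \<Rightarrow> complex ^ 'n option) \<Rightarrow> bool" where
  "transversal_disc K i b \<eta> \<sigma> \<longleftrightarrow>
     (\<forall>l. (\<lambda>\<zeta>. \<sigma> \<zeta> $ l) holomorphic_on ball 0 1) \<and>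
     (\<forall>\<zeta>\<in>ball 0 1. first_coords (\<sigma> \<zeta>) \<in> K) \<and>
     (\<forall>l. (\<forall>\<zeta>\<in>ball 0 1. \<sigma> \<zeta> $ Some l = \<sigma> 0 $ Some l) \<or> \<eta> \<le> cmod (deriv (\<lambda>\<zeta>. \<sigma> \<zeta> $ Some l) 0)) \<and>
     \<sigma> 0 $ Some i = b \<and> \<eta> \<le> cmod (deriv (\<lambda>\<zeta>. \<sigma> \<zeta> $ Some i) 0)"

definition near_root_sums ::
  "(nat \<Rightarrow> complex ^ ('n::finite) \<Rightarrow> complex) \<Rightarrow> nat \<Rightarrow> real \<Rightarrow> (complex \<Rightarrow> complex ^ 'n option) \<Rightarrow> bool" where
  "near_root_sums d n \<epsilon> \<sigma> \<longleftrightarrow>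
     (\<forall>\<zeta>\<in>ball 0 1. \<exists>t\<in>root_sums d n (first_coords (\<sigma> \<zeta>)). cmod (\<sigma> \<zeta> $ None - t) \<le> \<epsilon>)"

text \<open>
  Otherwise Montel's theorem yields a limit of transversal discs ever closer to the graph of the partial
  sums. The limit is transversal, and it lies in the graph since the eliminant vanishes on it. This
  contradicts the branching of the partial sums at the centre.
\<close>

lemma no_transversal_disc_near_root_sums:
  fixes K :: "(complex ^ 'n) set" and idx :: "nat \<Rightarrow> 'n" and a \<kappa> :: "nat \<Rightarrow> complex"
  defines "d \<equiv> \<lambda>j z. \<kappa> j * (z $ idx j - a j) ^ (2 * j + 1)"
  assumes K: "compact K" and \<kappa>: "\<And>j. \<kappa> j \<noteq> 0" and k: "k < n" and \<eta>: "0 < \<eta>"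
  shows "\<exists>\<epsilon>>0. \<forall>\<sigma>. transversal_disc K (idx k) (a k) \<eta> \<sigma> \<longrightarrow> \<not> near_root_sums d n \<epsilon> \<sigma>"
proof (rule ccontr)
  assume neg: "\<not> ?thesis"
  have "\<exists>\<sigma>. transversal_disc K (idx k) (a k) \<eta> \<sigma> \<and> near_root_sums d n (1 / real (Suc m)) \<sigma>" for m :: nat
  proof -
    have "0 < 1 / real (Suc m)" by simp
    then show ?thesis using neg by blast
  qed
  then obtain \<sigma> where \<sigma>: "\<And>m. transversal_disc K (idx k) (a k) \<eta> (\<sigma> m)"
    and near: "\<And>m. near_root_sums d n (1 / real (Suc m)) (\<sigma> m)"
    by metis
  have hol: "(\<lambda>\<zeta>. \<sigma> m \<zeta> $ l) holomorphic_on ball 0 1"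
    and in_K: "\<zeta> \<in> ball 0 1 \<Longrightarrow> first_coords (\<sigma> m \<zeta>) \<in> K"
    and alt: "(\<forall>\<zeta>\<in>ball 0 1. \<sigma> m \<zeta> $ Some i = \<sigma> m 0 $ Some i) \<or> \<eta> \<le> cmod (deriv (\<lambda>\<zeta>. \<sigma> m \<zeta> $ Some i) 0)"
    and at_0: "\<sigma> m 0 $ Some (idx k) = a k" "\<eta> \<le> cmod (deriv (\<lambda>\<zeta>. \<sigma> m \<zeta> $ Some (idx k)) 0)"
    for m l \<zeta> i
    using \<sigma>[of m] unfolding transversal_disc_def by blast+
  have d: "complex_polynomial (d j)" for j
    unfolding d_def by (intro complex_polynomial_mult complex_polynomial_power complex_polynomial_diff
        complex_polynomial_const complex_polynomial_coord)
  obtain B where B: "\<And>z t. z \<in> K \<Longrightarrow> t \<in> root_sums d n z \<Longrightarrow> cmod t \<le> B"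
    using root_sums_bounded[where d = d and n = n, OF K d] by blast
  obtain R where R: "\<And>z. z \<in> K \<Longrightarrow> norm z \<le> R"
    using compact_imp_bounded[OF K] by (auto simp: bounded_iff)
  have None_le: "cmod (\<sigma> m \<zeta> $ None) \<le> B + 1" if \<zeta>: "\<zeta> \<in> ball 0 1" for m \<zeta>
  proof -
    obtain t where t: "t \<in> root_sums d n (first_coords (\<sigma> m \<zeta>))" "cmod (\<sigma> m \<zeta> $ None - t) \<le> 1 / real (Suc m)"
      using near[of m] \<zeta> unfolding near_root_sums_def by blast
    have "1 / real (Suc m) \<le> 1" by simp
    then show ?thesis
      using t(2) B[OF in_K[OF \<zeta>] t(1)] norm_triangle_sub[of "\<sigma> m \<zeta> $ None" t] by linarith
  qed
  have bound: "cmod (\<sigma> m \<zeta> $ l) \<le> max R (B + 1)" if \<zeta>: "\<zeta> \<in> ball 0 1" for m \<zeta> l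
  proof (cases l)
    case None
    then show ?thesis using None_le[OF \<zeta>, of m] by simp
  next
    case (Some i)
    have "\<sigma> m \<zeta> $ Some i = first_coords (\<sigma> m \<zeta>) $ i" by (simp add: first_coords_def)
    then show ?thesis
      using R[OF in_K[OF \<zeta>, of m]] Finite_Cartesian_Product.norm_nth_le[of "first_coords (\<sigma> m \<zeta>)" i] Some
      by (simp add: le_max_iff_disj)
  qed
  obtain g r where r: "strict_mono (r :: nat \<Rightarrow> nat)" and g: "\<And>l. (\<lambda>\<zeta>. g \<zeta> $ l) holomorphic_on ball 0 1"
    and lim: "\<And>l K. compact K \<Longrightarrow> K \<subseteq> ball 0 1 \<Longrightarrow>
       uniform_limit K (\<lambda>n z. \<sigma> (r n) z $ l) (\<lambda>z. g z $ l) sequentially"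
    by (rule Montel_vec[of "ball 0 1" \<sigma>, OF open_ball hol bound]) (assumption | rule that)+
  have pointwise: "(\<lambda>m. \<sigma> (r m) \<zeta> $ l) \<longlonglongrightarrow> g \<zeta> $ l" if "\<zeta> \<in> ball 0 1" for \<zeta> l
    using lim[of "{\<zeta>}" l] that by simp
  have deriv_lim: "(\<lambda>m. deriv (\<lambda>\<zeta>. \<sigma> (r m) \<zeta> $ l) 0) \<longlonglongrightarrow> deriv (\<lambda>\<zeta>. g \<zeta> $ l) 0" for l
  proof (rule deriv_complex_uniform_limit)
    have "uniform_limit (cball 0 (1/2)) (\<lambda>n z. \<sigma> (r n) z $ l) (\<lambda>z. g z $ l) sequentially"
      by (intro lim) auto
    then show "uniform_limit (ball 0 (1/2)) (\<lambda>n z. \<sigma> (r n) z $ l) (\<lambda>z. g z $ l) sequentially"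
      by (rule uniform_limit_on_subset) (rule ball_subset_cball)
    show "\<forall>\<^sub>F m in sequentially. (\<lambda>\<zeta>. \<sigma> (r m) \<zeta> $ l) holomorphic_on ball 0 (1/2)"
      by (intro always_eventually allI holomorphic_on_subset[OF hol]) auto
  qed auto
  have deriv_ge: "\<eta> \<le> cmod (deriv (\<lambda>\<zeta>. g \<zeta> $ l) 0)"
    if "\<forall>\<^sub>F m in sequentially. \<eta> \<le> cmod (deriv (\<lambda>\<zeta>. \<sigma> (r m) \<zeta> $ l) 0)" for l
    by (rule tendsto_lowerbound[OF tendsto_norm[OF deriv_lim[of l]] that]) simp
  let ?f = "\<lambda>\<zeta>. first_coords (g \<zeta>)"
  have "\<exists>\<zeta>\<in>ball 0 1. g \<zeta> $ None \<notin> root_sums (\<lambda>j z. \<kappa> j * (z $ idx j - a j) ^ (2 * j + 1)) n (?f \<zeta>)"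
  proof (rule no_holomorphic_root_sum_near_simple_zero)
    show "(\<lambda>\<zeta>. ?f \<zeta> $ l) holomorphic_on ball 0 1" for l
      using g by (simp add: first_coords_def)
    show "(\<forall>\<zeta>\<in>ball 0 1. ?f \<zeta> $ l = ?f 0 $ l) \<or> deriv (\<lambda>\<zeta>. ?f \<zeta> $ l) 0 \<noteq> 0" for l
    proof (subst disj_commute, rule disjCI)
      assume "\<not> (\<forall>\<zeta>\<in>ball 0 1. ?f \<zeta> $ l = ?f 0 $ l)"
      then obtain \<zeta> where \<zeta>: "\<zeta> \<in> ball 0 1" "g \<zeta> $ Some l \<noteq> g 0 $ Some l"
        by (auto simp: first_coords_def)
      have "(\<lambda>m. \<sigma> (r m) \<zeta> $ Some l - \<sigma> (r m) 0 $ Some l) \<longlonglongrightarrow> g \<zeta> $ Some l - g 0 $ Some l"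
        using \<zeta>(1) by (intro tendsto_diff pointwise) auto
      then have "\<forall>\<^sub>F m in sequentially. \<sigma> (r m) \<zeta> $ Some l - \<sigma> (r m) 0 $ Some l \<noteq> 0"
        using \<zeta>(2) by (intro tendsto_imp_eventually_ne) auto
      then have "\<forall>\<^sub>F m in sequentially. \<eta> \<le> cmod (deriv (\<lambda>\<zeta>. \<sigma> (r m) \<zeta> $ Some l) 0)"
      proof eventually_elim
        case (elim m)
        have "\<not> (\<forall>\<xi>\<in>ball 0 1. \<sigma> (r m) \<xi> $ Some l = \<sigma> (r m) 0 $ Some l)"
        proof
          assume "\<forall>\<xi>\<in>ball 0 1. \<sigma> (r m) \<xi> $ Some l = \<sigma> (r m) 0 $ Some l"
          from bspec[OF this \<zeta>(1)] elim show False by simp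
        qed
        then show ?case using alt[of "r m" l] by blast
      qed
      then show "deriv (\<lambda>\<zeta>. ?f \<zeta> $ l) 0 \<noteq> 0"
        using deriv_ge[of "Some l"] \<eta> by (auto simp: first_coords_def)
    qed
    have "g 0 $ Some (idx k) = a k"
      using pointwise[of 0 "Some (idx k)"] at_0(1) by (simp add: LIMSEQ_const_iff)
    then show "?f 0 $ idx k = a k" by (simp add: first_coords_def)
    have "\<eta> \<le> cmod (deriv (\<lambda>\<zeta>. g \<zeta> $ Some (idx k)) 0)"
      using at_0(2) by (intro deriv_ge always_eventually) blast
    then show "deriv (\<lambda>\<zeta>. ?f \<zeta> $ idx k) 0 \<noteq> 0"
      using \<eta> by (auto simp: first_coords_def)
  qed (use g \<kappa> k in auto)
  then obtain \<zeta> where \<zeta>: "\<zeta> \<in> ball 0 1" "g \<zeta> $ None \<notin> root_sums d n (?f \<zeta>)"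
    unfolding d_def by blast
  obtain Q where Q: "complex_polynomial Q"
    and lower: "\<And>z w \<delta>. 0 \<le> \<delta> \<Longrightarrow> (\<And>t. t \<in> root_sums d n z \<Longrightarrow> \<delta> \<le> cmod (w - t)) \<Longrightarrow>
       \<delta> ^ 2 ^ n \<le> cmod (Q (append_coord z w))"
    and upper: "\<And>z w t \<tau> K. t \<in> root_sums d n z \<Longrightarrow> cmod (w - t) \<le> \<tau> \<Longrightarrow>
       (\<And>t. t \<in> root_sums d n z \<Longrightarrow> cmod (w - t) \<le> K) \<Longrightarrow>
       cmod (Q (append_coord z w)) \<le> \<tau> * K ^ (2 ^ n - 1)"
    using root_sums_eliminant[where d = d and n = n, OF d] by metis
  let ?C = "(B + 1 + B) ^ (2 ^ n - 1)"
  have small: "cmod (Q (\<sigma> m \<zeta>)) \<le> (1 / real (Suc m)) * ?C" for m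
  proof -
    let ?z = "first_coords (\<sigma> m \<zeta>)"
    obtain t where t: "t \<in> root_sums d n ?z" "cmod (\<sigma> m \<zeta> $ None - t) \<le> 1 / real (Suc m)"
      using near[of m] \<zeta>(1) unfolding near_root_sums_def by blast
    have "cmod (\<sigma> m \<zeta> $ None - t) \<le> B + 1 + B" if "t \<in> root_sums d n ?z" for t
      using norm_triangle_ineq4[of "\<sigma> m \<zeta> $ None" t] None_le[OF \<zeta>(1), of m] B[OF in_K[OF \<zeta>(1)] that] by linarith
    then have "cmod (Q (append_coord ?z (\<sigma> m \<zeta> $ None))) \<le> (1 / real (Suc m)) * ?C"
      by (rule upper[OF t])
    then show ?thesis by simp
  qed
  have "(\<lambda>m. \<sigma> (r m) \<zeta>) \<longlonglongrightarrow> g \<zeta>"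
    using pointwise[OF \<zeta>(1)] by (intro vec_tendstoI)
  then have "(\<lambda>m. Q (\<sigma> (r m) \<zeta>)) \<longlonglongrightarrow> Q (g \<zeta>)"
    by (rule continuous_on_tendsto_compose[OF complex_polynomial_continuous_on[OF Q, of UNIV]]) auto
  moreover have "(\<lambda>m. Q (\<sigma> (r m) \<zeta>)) \<longlonglongrightarrow> 0"
  proof (rule LIMSEQ_subseq_LIMSEQ[OF _ r, unfolded o_def])
    have "(\<lambda>m. 1 / real (Suc m) * ?C) \<longlonglongrightarrow> 0 * ?C"
      by (intro tendsto_mult tendsto_const lim_1_over_n[THEN LIMSEQ_Suc])
    then have "(\<lambda>m. 1 / real (Suc m) * ?C) \<longlonglongrightarrow> 0" by simp
    then show "(\<lambda>m. Q (\<sigma> m \<zeta>)) \<longlonglongrightarrow> 0"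
      by (rule Lim_null_comparison[rotated]) (intro always_eventually allI small)
  qed
  ultimately have Q0: "Q (g \<zeta>) = 0" by (rule LIMSEQ_unique)
  define \<delta> where "\<delta> = Min ((\<lambda>t. cmod (g \<zeta> $ None - t)) ` root_sums d n (?f \<zeta>))"
  have "0 < \<delta>"
    unfolding \<delta>_def using \<zeta>(2) by (subst Min_gr_iff) (auto simp: finite_root_sums root_sums_nonempty)
  moreover have "\<delta> \<le> cmod (g \<zeta> $ None - t)" if "t \<in> root_sums d n (?f \<zeta>)" for t
    unfolding \<delta>_def using that finite_root_sums by (intro Min_le) auto
  ultimately have "\<delta> ^ 2 ^ n \<le> cmod (Q (append_coord (?f \<zeta>) (g \<zeta> $ None)))"
    by (intro lower) auto
  then show False using Q0 zero_less_power[OF \<open>0 < \<delta>\<close>, of "2 ^ n"] by simp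
qed

section \<open>Choice of the coefficients\<close>

text \<open>
  The condition \<open>G c n \<epsilon>\<close> on a bound \<open>\<epsilon>\<close> for the \<open>n\<close>-th tail involves only the terms before \<open>n\<close>. Each new term is
  at most half of its predecessor and half of the bound allowed at its own stage, so the \<open>n\<close>-th tail is
  at most twice its first term.
\<close>

lemma rapidly_decreasing_sequence:
  fixes G :: "(nat \<Rightarrow> real) \<Rightarrow> nat \<Rightarrow> real \<Rightarrow> bool"
  assumes cong: "\<And>c c' n \<epsilon>. (\<And>j. j < n \<Longrightarrow> c j = c' j) \<Longrightarrow> G c n \<epsilon> \<Longrightarrow> G c' n \<epsilon>"
    and ex: "\<And>c n. (\<And>j. 0 < c j) \<Longrightarrow> \<exists>\<epsilon>>0. G c n \<epsilon>"
    and mono: "\<And>c n \<epsilon> \<delta>. G c n \<epsilon> \<Longrightarrow> \<delta> \<le> \<epsilon> \<Longrightarrow> G c n \<delta>"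
  obtains c where "\<And>j. 0 < c j" "summable c" "\<And>n. G c n (\<Sum>j. c (j + n))"
proof -
  let ?P = "\<lambda>c n x. 0 < x \<and> (\<forall>m. n = Suc m \<longrightarrow> x \<le> c m / 2) \<and> G c n (2 * x)"
  have "\<exists>c. \<forall>n. ?P c n (c n)"
  proof (rule dependent_wf_choice[OF wf_less])
    fix f g :: "nat \<Rightarrow> real" and n x
    assume eq: "\<And>z. (z, n) \<in> {(x, y). x < y} \<Longrightarrow> f z = g z"
    have "G f n (2 * x) \<longleftrightarrow> G g n (2 * x)"
      using cong[of n f g] cong[of n g f] eq by auto
    then show "?P f n x = ?P g n x" using eq by auto
  next
    fix n and f :: "nat \<Rightarrow> real"
    assume prev: "\<And>m. (m, n) \<in> {(x, y). x < y} \<Longrightarrow> ?P f m (f m)"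
    \<comment> \<open>the terms from \<open>n\<close> on are not chosen yet; any positive values will do\<close>
    define f' where "f' = (\<lambda>j. if j < n then f j else 1)"
    have "0 < f' j" for j using prev by (auto simp: f'_def)
    then obtain \<epsilon> where \<epsilon>: "0 < \<epsilon>" "G f' n \<epsilon>" using ex by blast
    define x where "x = (case n of 0 \<Rightarrow> \<epsilon> / 2 | Suc m \<Rightarrow> min (\<epsilon> / 2) (f m / 2))"
    have x: "0 < x" "2 * x \<le> \<epsilon>" "\<forall>m. n = Suc m \<longrightarrow> x \<le> f m / 2"
      using \<epsilon>(1) prev by (auto simp: x_def split: nat.splits)
    have "G f n \<epsilon>" by (rule cong[OF _ \<epsilon>(2)]) (simp add: f'_def)
    then have "G f n (2 * x)" using x(2) by (rule mono)
    with x show "\<exists>x. ?P f n x" by blast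
  qed
  then obtain c where c: "\<And>n. ?P c n (c n)" by blast
  have half: "c (j + n) \<le> c n * (1 / 2) ^ j" for j n
  proof (induction j)
    case (Suc j)
    have "c (Suc j + n) \<le> c (j + n) / 2" using c[of "Suc j + n"] by simp
    then show ?case using Suc by simp
  qed simp
  have geo: "summable (\<lambda>j. c n * (1 / 2) ^ j)" for n
    by (intro summable_mult summable_geometric) simp
  have sum: "summable (\<lambda>j. c (j + n))" for n
    using half c by (intro summable_comparison_test'[OF geo[of n], of 0]) (simp add: less_imp_le)
  have "(\<Sum>j. c (j + n)) \<le> (\<Sum>j. c n * (1 / 2) ^ j)" for n
    by (intro suminf_le half sum geo)
  moreover have "(\<Sum>j. c n * (1 / 2) ^ j) = 2 * c n" for n
    by (subst suminf_mult) (auto simp: suminf_geometric intro!: summable_geometric)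
  ultimately have "G c n (\<Sum>j. c (j + n))" for n
    using c[of n] mono by metis
  then show ?thesis using that[of c] c sum[of 0] by simp
qed

lemma dense_coordinate_values:
  obtains idx :: "nat \<Rightarrow> 'n::finite" and a :: "nat \<Rightarrow> complex"
  where "\<And>i U. open U \<Longrightarrow> U \<noteq> {} \<Longrightarrow> \<exists>k. idx k = i \<and> a k \<in> U"
proof -
  obtain D :: "complex set" where D: "countable D" "\<And>U. open U \<Longrightarrow> U \<noteq> {} \<Longrightarrow> \<exists>d\<in>D. d \<in> U"
    using countable_dense_setE by metis
  have "D \<noteq> {}" using D(2)[OF open_UNIV] by blast
  let ?E = "(UNIV :: 'n set) \<times> D"
  have E: "countable ?E" "?E \<noteq> {}" using D(1) \<open>D \<noteq> {}\<close> by auto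
  have "\<exists>k. fst (from_nat_into ?E k) = i \<and> snd (from_nat_into ?E k) \<in> U" if U: "open U" "U \<noteq> {}" for i U
  proof -
    obtain d where "d \<in> D" "d \<in> U" using D(2)[OF U] by blast
    moreover obtain k where "from_nat_into ?E k = (i, d)"
      using from_nat_into_surj[OF E(1), of "(i, d)"] \<open>d \<in> D\<close> by blast
    ultimately show ?thesis by (intro exI[of _ k]) simp
  qed
  then show ?thesis by (rule that)
qed

text \<open>
  Away from a discrete set the derivatives of all nonconstant coordinates are nonzero at once. The image
  of that region under one such coordinate is open by the open mapping theorem, so it contains one of
  the dense values \<open>a k\<close>. A small disc around a preimage, rescaled to the unit disc, is transversal, and
  \<open>n\<close> only has to be large enough.
\<close>

lemma transversal_subdisc:
  fixes K :: "(complex ^ ('n::finite)) set" and idx :: "nat \<Rightarrow> 'n" and a :: "nat \<Rightarrow> complex"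
  assumes dense: "\<And>i U. open U \<Longrightarrow> U \<noteq> {} \<Longrightarrow> \<exists>k. idx k = i \<and> a k \<in> U"
    and hol: "\<And>l. (\<lambda>\<zeta>. \<sigma> \<zeta> $ l) holomorphic_on ball 0 1"
    and in_K: "\<And>\<zeta>. \<zeta> \<in> ball 0 1 \<Longrightarrow> first_coords (\<sigma> \<zeta>) \<in> K"
    and nonconst: "\<not> (\<forall>\<zeta>\<in>ball 0 1. first_coords (\<sigma> \<zeta>) = first_coords (\<sigma> 0))"
  obtains k n \<zeta>\<^sub>0 r where "k < n" "0 < r" "ball \<zeta>\<^sub>0 r \<subseteq> ball 0 1"
    "transversal_disc K (idx k) (a k) (1 / (real n + 1)) (\<lambda>\<zeta>. \<sigma> (\<zeta>\<^sub>0 + of_real r * \<zeta>))"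
proof -
  let ?D = "ball (0::complex) 1"
  define f where "f = (\<lambda>l \<zeta>. \<sigma> \<zeta> $ Some l)"
  have f: "f l holomorphic_on ?D" for l unfolding f_def by (rule hol)
  define I where "I = {l. \<not> (\<forall>\<zeta>\<in>?D. f l \<zeta> = f l 0)}"
  obtain l\<^sub>0 where l\<^sub>0: "l\<^sub>0 \<in> I"
    using nonconst unfolding I_def f_def first_coords_def by (auto simp: vec_eq_iff)
  let ?P = "\<lambda>\<zeta>. \<Prod>l\<in>I. deriv (f l) \<zeta>"
  have P: "?P holomorphic_on ?D"
    by (intro holomorphic_on_prod holomorphic_deriv f) auto
  have "\<exists>\<zeta>\<in>?D. ?P \<zeta> \<noteq> 0"
  proof (rule ccontr)
    assume "\<not> ?thesis"
    then have zero: "?P \<zeta> = 0" if "\<zeta> \<in> ?D" for \<zeta> using that by blast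
    have dhol: "deriv (f l) holomorphic_on ?D" for l by (intro holomorphic_deriv f) auto
    obtain l where l: "l \<in> I" "\<And>\<zeta>. \<zeta> \<in> ?D \<Longrightarrow> deriv (f l) \<zeta> = 0"
      by (rule holomorphic_prod_eq_0[OF open_ball connected_ball _ finite dhol zero]) (auto intro: that)
    have "(f l has_field_derivative 0) (at \<zeta> within ?D)" if "\<zeta> \<in> ?D" for \<zeta>
      using holomorphic_derivI[OF f open_ball that, of l] l(2)[OF that] by (simp add: has_field_derivative_at_within)
    then obtain c where "\<And>\<zeta>. \<zeta> \<in> ?D \<Longrightarrow> f l \<zeta> = c"
      using has_field_derivative_zero_constant[OF convex_ball] by metis
    then have "\<forall>\<zeta>\<in>?D. f l \<zeta> = f l 0" by simp
    with l(1) show False unfolding I_def by blast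
  qed
  define U where "U = {\<zeta> \<in> ?D. ?P \<zeta> \<noteq> 0}"
  have "open (?P -` (- {0}) \<inter> ?D)"
    using holomorphic_on_imp_continuous_on[OF P] by (auto simp: continuous_on_open_vimage)
  moreover have "?P -` (- {0}) \<inter> ?D = U" unfolding U_def by auto
  ultimately have U: "open U" "U \<noteq> {}" "U \<subseteq> ?D"
    using \<open>\<exists>\<zeta>\<in>?D. ?P \<zeta> \<noteq> 0\<close> unfolding U_def by auto
  have "\<not> f l\<^sub>0 constant_on ?D"
    using l\<^sub>0 unfolding I_def constant_on_def by force
  then have "open (f l\<^sub>0 ` U)"
    using open_mapping_thm[OF f open_ball connected_ball U(1,3)] by blast
  then obtain k where k: "idx k = l\<^sub>0" "a k \<in> f l\<^sub>0 ` U" using dense U(2) by blast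
  from k(2) obtain \<zeta>\<^sub>0 where \<zeta>\<^sub>0: "a k = f l\<^sub>0 \<zeta>\<^sub>0" "\<zeta>\<^sub>0 \<in> U" by (rule imageE)
  then have "\<zeta>\<^sub>0 \<in> ?D" using U(3) by blast
  then obtain r where r: "0 < r" "ball \<zeta>\<^sub>0 r \<subseteq> ?D"
    using open_ball[of "0::complex" 1] unfolding open_contains_ball by blast
  define m where "m = (\<lambda>\<zeta>::complex. \<zeta>\<^sub>0 + of_real r * \<zeta>)"
  have m: "m \<zeta> \<in> ball \<zeta>\<^sub>0 r" if "\<zeta> \<in> ?D" for \<zeta>
    using that r(1) by (simp add: m_def dist_norm norm_mult)
  have m_D: "m \<zeta> \<in> ?D" if "\<zeta> \<in> ?D" for \<zeta> using m[OF that] r(2) by blast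
  have m_hol: "m holomorphic_on ?D" unfolding m_def by (intro holomorphic_intros)
  have deriv_m: "deriv (\<lambda>\<zeta>. f l (m \<zeta>)) 0 = of_real r * deriv (f l) \<zeta>\<^sub>0" for l
  proof (rule DERIV_imp_deriv)
    have "(f l has_field_derivative deriv (f l) \<zeta>\<^sub>0) (at (m 0))"
      using holomorphic_derivI[OF f open_ball \<open>\<zeta>\<^sub>0 \<in> ?D\<close>, of l] by (simp add: m_def)
    moreover have "(m has_field_derivative of_real r) (at 0)"
      unfolding m_def by (auto intro!: derivative_eq_intros)
    ultimately show "((\<lambda>\<zeta>. f l (m \<zeta>)) has_field_derivative of_real r * deriv (f l) \<zeta>\<^sub>0) (at 0)"
      using DERIV_chain2 by (fastforce simp: mult.commute)
  qed
  define \<eta> where "\<eta> = Min ((\<lambda>l. r * cmod (deriv (f l) \<zeta>\<^sub>0)) ` I)"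
  have "0 < \<eta>"
    unfolding \<eta>_def using l\<^sub>0 \<zeta>\<^sub>0(2) r(1) by (subst Min_gr_iff) (auto simp: U_def prod_zero_iff)
  have \<eta>_le: "\<eta> \<le> cmod (deriv (\<lambda>\<zeta>. f l (m \<zeta>)) 0)" if "l \<in> I" for l
    unfolding deriv_m norm_mult \<eta>_def using that r(1) by (intro Min_le) auto
  obtain n' :: nat where n': "1 / \<eta> < real n'" using reals_Archimedean2 by blast
  define n where "n = max n' (Suc k)"
  have "real n' \<le> real n" by (simp add: n_def)
  with n' have "1 / \<eta> < real n" by linarith
  then have n: "1 / (real n + 1) \<le> \<eta>" using \<open>0 < \<eta>\<close> by (simp add: field_simps)
  have "transversal_disc K (idx k) (a k) (1 / (real n + 1)) (\<lambda>\<zeta>. \<sigma> (m \<zeta>))"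
    unfolding transversal_disc_def
  proof (intro conjI allI ballI)
    show "(\<lambda>\<zeta>. \<sigma> (m \<zeta>) $ l) holomorphic_on ?D" for l
      by (rule holomorphic_on_compose_gen[OF m_hol hol, unfolded o_def]) (use m_D in blast)
    show "first_coords (\<sigma> (m \<zeta>)) \<in> K" if "\<zeta> \<in> ?D" for \<zeta>
      using in_K m_D[OF that] by blast
    show "(\<forall>\<zeta>\<in>?D. \<sigma> (m \<zeta>) $ Some l = \<sigma> (m 0) $ Some l) \<or>
        1 / (real n + 1) \<le> cmod (deriv (\<lambda>\<zeta>. \<sigma> (m \<zeta>) $ Some l) 0)" for l
    proof (cases "l \<in> I")
      case True
      then show ?thesis using \<eta>_le[OF True] n by (auto simp: f_def)
    next
      case False
      then have "\<forall>\<zeta>\<in>?D. f l \<zeta> = f l 0" unfolding I_def by blast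
      then have "\<sigma> \<zeta> $ Some l = \<sigma> 0 $ Some l" if "\<zeta> \<in> ?D" for \<zeta>
        unfolding f_def using that by (rule bspec)
      from this[OF m_D] this[OF m_D[of 0]] show ?thesis by simp
    qed
    show "\<sigma> (m 0) $ Some (idx k) = a k"
      using \<zeta>\<^sub>0(1) k(1) by (simp add: m_def f_def)
    show "1 / (real n + 1) \<le> cmod (deriv (\<lambda>\<zeta>. \<sigma> (m \<zeta>) $ Some (idx k)) 0)"
      using \<eta>_le[OF l\<^sub>0] n k(1) by (simp add: f_def)
  qed
  moreover have "k < n" by (simp add: n_def)
  ultimately show ?thesis using r by (intro that[of k n r \<zeta>\<^sub>0]) (simp_all add: m_def)
qed

theorem theorem1p1:
  fixes X :: "(complex ^ 'n) set"
  assumes "compact X"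
    and "polynomial_hull X - X \<noteq> {}"
  shows "\<exists>Y :: (complex ^ 'n option) set.
           compact Y \<and>
           first_coords ` Y = X \<and>
           first_coords ` (polynomial_hull Y - Y) = polynomial_hull X - X \<and>
           contains_no_analytic_discs (polynomial_hull Y) \<and>
           (\<forall>z \<in> polynomial_hull X.
              totally_disconnected {w \<in> polynomial_hull Y. first_coords w = z})"
proof -
  let ?H = "polynomial_hull X"
  have X: "compact X" "X \<noteq> {}" using assms by (auto simp: polynomial_hull_empty)
  have H: "compact ?H" by (rule compact_polynomial_hull[OF X(1)])
  obtain R where R: "R > 0" "\<And>z i. z \<in> ?H \<Longrightarrow> cmod (z $ i) \<le> R"
    using polynomial_hull_coord_bounded[OF X(1)] by metis
  obtain idx :: "nat \<Rightarrow> 'n" and a :: "nat \<Rightarrow> complex"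
    where dense: "\<And>i U. open U \<Longrightarrow> U \<noteq> {} \<Longrightarrow> \<exists>k. idx k = i \<and> a k \<in> U"
    by (rule dense_coordinate_values) (rule that)
  \<comment> \<open>the second factor normalises \<open>z\<^sub>i - a\<^sub>j\<close> to modulus at most \<open>1\<close> on the hull\<close>
  define \<kappa> where "\<kappa> = (\<lambda>(c :: nat \<Rightarrow> real) j. complex_of_real ((c j)\<^sup>2 * (1 / (R + cmod (a j))) ^ (2 * j + 1)))"
  define d where "d = (\<lambda>c j (z :: complex ^ 'n). \<kappa> c j * (z $ idx j - a j) ^ (2 * j + 1))"
  \<comment> \<open>the conditions on the \<open>n\<close>-th tail: the rate needed for the hull and the fibres, and the absence of discs\<close>
  define G where "G = (\<lambda>c n \<epsilon>. \<epsilon> \<le> (1 / (real n + 2)) ^ 2 ^ n \<and>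
    (\<forall>k<n. \<forall>\<sigma>. transversal_disc ?H (idx k) (a k) (1 / (real n + 1)) \<sigma> \<longrightarrow> \<not> near_root_sums (d c) n \<epsilon> \<sigma>))"
  have Ra: "0 < R + cmod (a j)" for j using R(1) by (simp add: add_pos_nonneg)
  obtain c where c: "\<And>j. 0 < c j" "summable c" "\<And>n. G c n (\<Sum>j. c (j + n))"
  proof (rule rapidly_decreasing_sequence[of G])
    fix c c' :: "nat \<Rightarrow> real" and n \<epsilon>
    assume "\<And>j. j < n \<Longrightarrow> c j = c' j" and G: "G c n \<epsilon>"
    then have "d c j = d c' j" if "j < n" for j using that by (simp add: d_def \<kappa>_def)
    then have "root_sums (d c) n z = root_sums (d c') n z" for z by (rule root_sums_cong)
    with G show "G c' n \<epsilon>" unfolding G_def near_root_sums_def by simp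
  next
    fix c n \<epsilon> \<delta>
    assume G: "G c n \<epsilon>" and \<delta>: "\<delta> \<le> \<epsilon>"
    then have "near_root_sums (d c) n \<delta> \<sigma> \<Longrightarrow> near_root_sums (d c) n \<epsilon> \<sigma>" for \<sigma>
      unfolding near_root_sums_def by (meson order_trans)
    with G \<delta> show "G c n \<delta>" unfolding G_def by (meson order_trans)
  next
    fix c :: "nat \<Rightarrow> real" and n
    assume pos: "\<And>j. 0 < c j"
    have \<kappa>: "\<kappa> c j \<noteq> 0" for j
    proof -
      have "0 < (c j)\<^sup>2 * (1 / (R + cmod (a j))) ^ (2 * j + 1)"
        using pos[of j] Ra[of j] by (intro mult_pos_pos zero_less_power divide_pos_pos) auto
      then show ?thesis unfolding \<kappa>_def of_real_eq_0_iff by linarith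
    qed
    let ?good = "\<lambda>k \<epsilon>. \<forall>\<sigma>. transversal_disc ?H (idx k) (a k) (1 / (real n + 1)) \<sigma> \<longrightarrow> \<not> near_root_sums (d c) n \<epsilon> \<sigma>"
    have "\<exists>\<epsilon>>0. ?good k \<epsilon>" if "k < n" for k
      using no_transversal_disc_near_root_sums[where \<kappa> = "\<kappa> c" and idx = idx and a = a, OF H \<kappa> that] unfolding d_def by simp
    then obtain \<epsilon> where \<epsilon>: "\<And>k. k < n \<Longrightarrow> 0 < \<epsilon> k" "\<And>k. k < n \<Longrightarrow> ?good k (\<epsilon> k)" by metis
    define \<delta> where "\<delta> = Min (insert ((1 / (real n + 2)) ^ 2 ^ n) (\<epsilon> ` {..<n}))"
    have "0 < \<delta>" unfolding \<delta>_def using \<epsilon>(1) by (subst Min_gr_iff) auto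
    moreover have "?good k \<delta>" if "k < n" for k
    proof -
      have "\<delta> \<le> \<epsilon> k" unfolding \<delta>_def using that by (intro Min_le) auto
      then have "near_root_sums (d c) n \<delta> \<sigma> \<Longrightarrow> near_root_sums (d c) n (\<epsilon> k) \<sigma>" for \<sigma>
        unfolding near_root_sums_def by (meson order_trans)
      then show ?thesis using \<epsilon>(2)[OF that] by blast
    qed
    moreover have "\<delta> \<le> (1 / (real n + 2)) ^ 2 ^ n" unfolding \<delta>_def by (intro Min_le) auto
    ultimately show "\<exists>\<epsilon>>0. G c n \<epsilon>" unfolding G_def by blast
  qed (rule that)
  interpret small_roots "d c" c X
  proof
    show "complex_polynomial (d c j)" for j
      unfolding d_def by (intro complex_polynomial_mult complex_polynomial_power complex_polynomial_diff
          complex_polynomial_const complex_polynomial_coord)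
    show "cmod (d c j z) \<le> (c j)\<^sup>2" if z: "z \<in> ?H" for j z
    proof -
      let ?p = "cmod (z $ idx j - a j) / (R + cmod (a j))"
      have "cmod (z $ idx j - a j) \<le> R + cmod (a j)"
        using norm_triangle_ineq4[of "z $ idx j" "a j"] R(2)[OF z, of "idx j"] by linarith
      then have "?p ^ (2 * j + 1) \<le> 1" using Ra[of j] by (intro power_le_one) auto
      then have "(c j)\<^sup>2 * ?p ^ (2 * j + 1) \<le> (c j)\<^sup>2 * 1" by (intro mult_left_mono) auto
      moreover have "cmod (d c j z) = (c j)\<^sup>2 * ?p ^ (2 * j + 1)"
        using Ra[of j] unfolding d_def \<kappa>_def norm_mult norm_power norm_of_real
        by (simp add: abs_mult power_abs power_divide)
      ultimately show ?thesis by simp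
    qed
    show "(\<Sum>j. c (j + n)) \<le> (1 / (real n + 2)) ^ 2 ^ n" for n
      using c(3)[of n] unfolding G_def by blast
  qed (use X c in \<open>auto simp: less_imp_le\<close>)
  define Y where "Y = root_graph (d c) X"
  have hull_Y: "polynomial_hull Y = root_graph (d c) ?H"
    unfolding Y_def by (rule hull_root_graph)
  have "compact Y"
    unfolding Y_def by (rule compact_root_graph[OF X(1) subset_polynomial_hull[OF X(1)]])
  moreover have "first_coords ` Y = X"
    unfolding Y_def by (rule first_coords_root_graph)
  moreover have "first_coords ` (polynomial_hull Y - Y) = ?H - X"
  proof -
    have "polynomial_hull Y - Y = root_graph (d c) (?H - X)"
      unfolding hull_Y by (auto simp: Y_def mem_root_graph_iff)
    then show ?thesis by (simp add: first_coords_root_graph)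
  qed
  moreover have fibres: "\<forall>z\<in>?H. totally_disconnected {w \<in> polynomial_hull Y. first_coords w = z}"
    unfolding hull_Y using totally_disconnected_fibre by blast
  moreover have "contains_no_analytic_discs (polynomial_hull Y)"
    unfolding contains_no_analytic_discs_def
  proof
    let ?D = "ball (0::complex) 1"
    assume "\<exists>\<sigma>. analytic_disc \<sigma> \<and> \<sigma> ` ?D \<subseteq> polynomial_hull Y"
    then obtain \<sigma> where hol: "\<And>l. (\<lambda>\<zeta>. \<sigma> \<zeta> $ l) holomorphic_on ?D" and inj: "inj_on \<sigma> ?D"
      and sub: "\<sigma> ` ?D \<subseteq> polynomial_hull Y"
      unfolding analytic_disc_def by blast
    have mem: "first_coords (\<sigma> \<zeta>) \<in> ?H" "\<sigma> \<zeta> $ None \<in> limit_root_sums (d c) (first_coords (\<sigma> \<zeta>))"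
      if "\<zeta> \<in> ?D" for \<zeta>
    proof -
      have "\<sigma> \<zeta> \<in> root_graph (d c) ?H" using sub imageI[OF that, of \<sigma>] unfolding hull_Y by blast
      then show "first_coords (\<sigma> \<zeta>) \<in> ?H" "\<sigma> \<zeta> $ None \<in> limit_root_sums (d c) (first_coords (\<sigma> \<zeta>))"
        unfolding mem_root_graph_iff by blast+
    qed
    \<comment> \<open>a disc inside a fibre would be a point\<close>
    have "\<not> (\<forall>\<zeta>\<in>?D. first_coords (\<sigma> \<zeta>) = first_coords (\<sigma> 0))"
    proof
      assume "\<forall>\<zeta>\<in>?D. first_coords (\<sigma> \<zeta>) = first_coords (\<sigma> 0)"
      then have "\<sigma> ` ?D \<subseteq> {w \<in> polynomial_hull Y. first_coords w = first_coords (\<sigma> 0)}"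
        using sub by blast
      moreover have "connected (\<sigma> ` ?D)"
      proof (rule connected_continuous_image)
        have "continuous_on ?D (\<lambda>\<zeta>. \<chi> l. \<sigma> \<zeta> $ l)"
          by (intro continuous_on_vec_lambda holomorphic_on_imp_continuous_on hol)
        then show "continuous_on ?D \<sigma>" by simp
      qed simp
      moreover have in_D: "0 \<in> ?D" "1 / 2 \<in> ?D" by (auto simp: norm_divide)
      ultimately have "\<sigma> 0 = \<sigma> (1 / 2)"
        using fibres mem(1)[OF in_D(1)] unfolding totally_disconnected_def by (meson image_eqI)
      then show False using inj_onD[OF inj _ in_D] by simp
    qed
    then obtain k n \<zeta>\<^sub>0 r where kn: "k < n" and r: "0 < r" "ball \<zeta>\<^sub>0 r \<subseteq> ?D"
      and transversal: "transversal_disc ?H (idx k) (a k) (1 / (real n + 1)) (\<lambda>\<zeta>. \<sigma> (\<zeta>\<^sub>0 + of_real r * \<zeta>))"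
      by (rule transversal_subdisc[OF dense hol mem(1), rotated 3]) (assumption | rule that)+
    have "near_root_sums (d c) n (tail n) (\<lambda>\<zeta>. \<sigma> (\<zeta>\<^sub>0 + of_real r * \<zeta>))"
      unfolding near_root_sums_def
    proof
      fix \<zeta> assume "\<zeta> \<in> ?D"
      then have "\<zeta>\<^sub>0 + of_real r * \<zeta> \<in> ball \<zeta>\<^sub>0 r" using r(1) by (simp add: dist_norm norm_mult)
      then have in_D: "\<zeta>\<^sub>0 + of_real r * \<zeta> \<in> ?D" using r(2) by blast
      show "\<exists>t\<in>root_sums (d c) n (first_coords (\<sigma> (\<zeta>\<^sub>0 + of_real r * \<zeta>))).
          cmod (\<sigma> (\<zeta>\<^sub>0 + of_real r * \<zeta>) $ None - t) \<le> tail n"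
        by (rule limit_near_root_sums[OF mem[OF in_D], of n]) (rule bexI)
    qed
    then show False using c(3)[of n] kn transversal unfolding G_def by blast
  qed
  ultimately show ?thesis by blast
qed

end
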